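(* Let $f:\mathbb{R}^2\to[0,+\infty)$ be a function whose graph is closed (in $\mathbb{R}^2\times[0,+\infty)$), connected and locally connected. Suppose that the set $D_f$ of all points of discontinuity of $f$ is a non-empty locally connected continuum not separated by any point, and that the restriction $f|D_f$ is discontinuous. Then the function $f|D_f:D_f\to[0,+\infty)$ has infinitely many points of discontinuity.
   Context: $D_f$ is the set of points of $\mathbb{R}^2$ at which $f$ is not continuous; $f|D_f$ is the restriction of $f$ to the subspace $D_f$. The graph of $f$ is $\{(x,f(x)):x\in\mathbb{R}^2\}$ with the subspace topology of the product. A continuum is a compact connected metrisable space. A set $E$ is not separated by any point if $E\setminus\{p\}$ is connected for every $p\in E$. *)

theory Defs
  imports "HOL-Analysis.Analysis"
begin

definition graph_of :: "('a \<Rightarrow> 'b) \<Rightarrow> ('a \<times> 'b) set"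
  where "graph_of f = {(x, f x) | x. True}"

(* Points of discontinuity of the restriction of f to the subspace S;
   for S = UNIV these are the points of discontinuity of f itself. *)
definition discont_points :: "'a::t2_space set \<Rightarrow> ('a \<Rightarrow> 'b::topological_space) \<Rightarrow> 'a set"
  where "discont_points S f = {x \<in> S. \<not> continuous (at x within S) f}"

(* Metrisability of the subspace is automatic in a metric space. *)
definition continuum :: "'a::metric_space set \<Rightarrow> bool"
  where "continuum E \<longleftrightarrow> compact E \<and> connected E"

definition not_separated_by_any_point :: "'a::topological_space set \<Rightarrow> bool"
  where "not_separated_by_any_point E \<longleftrightarrow> (\<forall>p\<in>E. connected (E - {p}))"

end

theory Submission
  imports Defs "HOL-Complex_Analysis.Riemann_Mapping"
begin

text \<open>
  Suppose that the set \<open>P\<close> of discontinuities of \<open>f|D\<close> is finite. The proof shows that \<open>P\<close> is then empty,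
  which contradicts the discontinuity of \<open>f|D\<close>.

  \<^bold>\<open>A phase that does not see the jumps.\<close> The graph is closed and \<open>f\<close> is nonnegative, so near a point \<open>x\<close>
  every value of \<open>f\<close> is either close to \<open>f x\<close> or very large (\<open>closed_graph_near\<close>). Let \<open>F\<close> be a
  continuous extension of \<open>f|(D - P)\<close> to the complement of \<open>P\<close>, and let \<open>\<kappa>\<close> be \<open>f - F\<close> clamped to \<open>[0,1]\<close>. At a
  point of \<open>D - P\<close> the function \<open>\<kappa>\<close> jumps from 0 to exactly 1, so \<open>exp (2\<pi>i\<kappa>)\<close> is continuous off \<open>P\<close>
  (\<open>phase_exists\<close>). Inside a Jordan curve that encloses no point of \<open>P\<close> it has a continuous logarithm
  \<open>2\<pi>i\<tau>\<close>. The integer \<open>s = \<kappa> - \<tau>\<close> is locally constant along the graph of \<open>f\<close>, but it increases by 1 when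
  one leaves a point of \<open>D\<close> towards the large values of \<open>f\<close> (\<open>level_exists\<close>).

  \<^bold>\<open>Jump loops.\<close> A jump loop is a simple closed curve along which \<open>f\<close> is continuous except for one jump at
  a point of \<open>P\<close>, and over which the graph is still path connected. Every jump loop encloses a point of \<open>P\<close> (\<open>jump_loop_encloses_P\<close>). Otherwise \<open>s\<close> exists
  inside. On the part of \<open>D\<close> inside the loop it has only finitely many values, because \<open>D - P\<close> has finitely
  many components; so the level just above the largest of them (any level, if there are none) is attained, and only off
  \<open>D\<close>, where \<open>f\<close> is continuous. That level set \<open>Z\<close> is therefore open and relatively closed in the graph inside the loop. If it had a
  limit \<open>(t, f t)\<close> with \<open>t\<close> on the loop, then \<open>Z\<close> would contain all interior points near \<open>t\<close>, with \<open>f\<close> bounded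
  there. This property spreads along the loop by connectedness, and at the jump it is absurd. Hence
  \<open>Z\<close> splits the connected graph of \<open>f\<close>.

  \<^bold>\<open>Descent.\<close> Let \<open>q \<in> P\<close> lie inside a jump loop. A locally connected closed set is locally path connected
  (\<open>path_connected_if_locally_connected\<close>). Applied to \<open>D\<close>, this gives an arc in \<open>D\<close> that ends in \<open>q\<close> and
  along which \<open>f\<close> stays well above \<open>f q\<close>; applied to the graph, it gives an arc over the closed region that returns from
  there to \<open>q\<close> with \<open>f\<close> continuous on it. Together they contain a jump loop at \<open>q\<close> inside the first one, with fewer
  points of \<open>P\<close> in its interior. So there is no jump loop at all (\<open>no_jump_loop\<close>), although the same
  construction in the whole plane yields one as soon as \<open>P\<close> is nonempty.
\<close>

section \<open>Locally connected closed sets are locally path connected\<close>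

definition small_link :: "'a::metric_space set \<Rightarrow> 'a set \<Rightarrow> real \<Rightarrow> 'a set \<Rightarrow> bool"
  where "small_link S V e W \<longleftrightarrow> openin (top_of_set S) W \<and> connected W \<and> closure W \<subseteq> V
           \<and> (\<forall>u\<in>W. \<forall>v\<in>W. dist u v \<le> e)"

lemma small_link_around:
  fixes S :: "'a::metric_space set"
  assumes "closed S" "locally connected S" "openin (top_of_set S) V" "a \<in> V" "0 < e"
  obtains W where "small_link S V e W" "a \<in> W"
proof -
  obtain O' where O': "open O'" "V = S \<inter> O'"
    using assms(3) openin_open by blast
  then obtain d where d: "d > 0" "cball a d \<subseteq> O'"
    using assms(4) open_contains_cball by blast
  define d' where "d' = min d (e/2)"
  have d': "d' > 0" "cball a d' \<subseteq> O'" "d' \<le> e/2" using d assms(5) by (auto simp: d'_def)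
  have "openin (top_of_set S) (S \<inter> ball a d')" by (simp add: openin_open_Int)
  moreover have "a \<in> S \<inter> ball a d'" using assms(4) O' d' by auto
  ultimately obtain W where W: "openin (top_of_set S) W" "connected W" "a \<in> W" "W \<subseteq> S \<inter> ball a d'"
    using assms(2) unfolding locally_connected by meson
  have "closure W \<subseteq> S \<inter> cball a d'"
    using W(4) assms(1) by (intro closure_minimal) (auto intro: closed_Int)
  then have "closure W \<subseteq> V" using d' O' by blast
  moreover have "dist u v \<le> e" if "u \<in> W" "v \<in> W" for u v
  proof -
    have "dist a u < d'" "dist a v < d'" using W(4) that by auto
    then show ?thesis using d'(3) dist_triangle3[of u v a] by linarith
  qed
  ultimately show ?thesis using that W unfolding small_link_def by blast
qed

text \<open>
  Being joined by a chain of small links is an equivalence relation with open classes. Repeating the last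
  point gives chains of every sufficiently large length, which later makes a common subdivision possible.
\<close>

lemma small_link_chain:
  fixes S :: "'a::metric_space set"
  assumes S: "closed S" "locally connected S" and V: "openin (top_of_set S) V" "connected V"
    and xy: "x \<in> V" "y \<in> V" and e: "0 < e"
  shows "\<exists>N. \<forall>n\<ge>N. \<exists>g. g 0 = x \<and> g n = y \<and> (\<forall>i<n. \<exists>W. small_link S V e W \<and> g i \<in> W \<and> g (Suc i) \<in> W)"
proof -
  define r where "r a b \<longleftrightarrow> (\<exists>W. small_link S V e W \<and> a \<in> W \<and> b \<in> W)" for a b
  have symr: "r a b \<Longrightarrow> r b a" for a b unfolding r_def by blast
  have "r\<^sup>*\<^sup>* x y"
  proof (rule connected_equivalence_relation[OF V(2) xy])
    show "r\<^sup>*\<^sup>* b a" if "r\<^sup>*\<^sup>* a b" for a b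
      using that symr by (metis symp_def symp_rtranclp)
    show "r\<^sup>*\<^sup>* a c" if "r\<^sup>*\<^sup>* a b" "r\<^sup>*\<^sup>* b c" for a b c
      using that by auto
    show "\<exists>T. openin (top_of_set V) T \<and> a \<in> T \<and> (\<forall>x\<in>T. r\<^sup>*\<^sup>* a x)" if "a \<in> V" for a
    proof -
      obtain W where W: "small_link S V e W" "a \<in> W"
        by (rule small_link_around[OF S V(1) \<open>a \<in> V\<close> e])
      then have "W \<subseteq> V" unfolding small_link_def using closure_subset by blast
      moreover have "V \<subseteq> S" using V(1) openin_imp_subset by blast
      ultimately have "openin (top_of_set V) W"
        using W(1) unfolding small_link_def by (meson openin_subset_trans)
      then show ?thesis using W unfolding r_def by blast
    qed
  qed
  then obtain N where N: "(r ^^ N) x y" using rtranclp_imp_relpowp by metis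
  then obtain f where f: "f 0 = x" "f N = y" "\<And>i. i < N \<Longrightarrow> r (f i) (f (Suc i))"
    unfolding relpowp_fun_conv by blast
  have ryy: "r y y" by (rule small_link_around[OF S V(1) xy(2) e]) (auto simp: r_def)
  show ?thesis
  proof (intro exI[of _ N] allI impI)
    fix n assume "N \<le> n"
    define g where "g i = (if i \<le> N then f i else y)" for i
    have "r (g i) (g (Suc i))" if "i < n" for i
      using f ryy unfolding g_def
      by (cases "i < N"; cases "i = N") auto
    moreover have "g 0 = x" "g n = y" using f \<open>N \<le> n\<close> by (auto simp: g_def)
    ultimately show "\<exists>g. g 0 = x \<and> g n = y \<and> (\<forall>i<n. \<exists>W. small_link S V e W \<and> g i \<in> W \<and> g (Suc i) \<in> W)"
      unfolding r_def by blast
  qed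
qed

text \<open>
  The data of one stage in the construction of a path: points \<open>p 0, \<dots>, p M\<close> in which consecutive ones are
  linked by small connected sets \<open>W 0, \<dots>, W (M - 1)\<close>. Stage \<open>(M, p, W)\<close> describes the path on the uniform grid of
  mesh \<open>1 / M\<close>.
\<close>

definition link_chain :: "'a::metric_space set \<Rightarrow> 'a set \<Rightarrow> real \<Rightarrow> nat \<times> (nat \<Rightarrow> 'a) \<times> (nat \<Rightarrow> 'a set) \<Rightarrow> bool"
  where "link_chain S V e = (\<lambda>(M, p, W). M > 0 \<and> (\<forall>k<M. openin (top_of_set S) (W k) \<and> connected (W k)
     \<and> p k \<in> W k \<and> p (Suc k) \<in> W k \<and> closure (W k) \<subseteq> V \<and> (\<forall>u\<in>W k. \<forall>v\<in>W k. dist u v \<le> e)))"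

text \<open>
  All links are subdivided into the same number \<open>m\<close> of smaller ones, so that the new grid is again uniform and
  the link over the cell \<open>i\<close> of the new grid lies in the link over the cell \<open>i div m\<close> of the old one.
\<close>

definition refines :: "nat \<times> (nat \<Rightarrow> 'a::metric_space) \<times> (nat \<Rightarrow> 'a set) \<Rightarrow> nat \<times> (nat \<Rightarrow> 'a) \<times> (nat \<Rightarrow> 'a set) \<Rightarrow> bool"
  where "refines = (\<lambda>(M, p, W) (M', p', W'). \<exists>m>0. M' = M * m \<and> (\<forall>k\<le>M. p' (k * m) = p k)
     \<and> (\<forall>i<M'. W' i \<subseteq> W (i div m)))"

lemma link_chain_refine:
  fixes S :: "'a::metric_space set"
  assumes S: "closed S" "locally connected S" and e': "0 < e'"
    and c: "link_chain S V e (M, p, W)"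
  shows "\<exists>c'. link_chain S V e' c' \<and> refines (M, p, W) c'"
proof -
  have c: "M > 0" "\<And>k. k < M \<Longrightarrow> openin (top_of_set S) (W k) \<and> connected (W k)
     \<and> p k \<in> W k \<and> p (Suc k) \<in> W k \<and> closure (W k) \<subseteq> V"
    using c unfolding link_chain_def by auto
  have "\<forall>k\<in>{..<M}. \<exists>N. \<forall>n\<ge>N. \<exists>g. g 0 = p k \<and> g n = p (Suc k) \<and>
      (\<forall>i<n. \<exists>X. small_link S (W k) e' X \<and> g i \<in> X \<and> g (Suc i) \<in> X)"
    using c(2) by (intro ballI small_link_chain[OF S _ _ _ _ e']) auto
  then obtain N where N: "\<And>k n. k < M \<Longrightarrow> N k \<le> n \<Longrightarrow> \<exists>g. g 0 = p k \<and> g n = p (Suc k) \<and>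
      (\<forall>i<n. \<exists>X. small_link S (W k) e' X \<and> g i \<in> X \<and> g (Suc i) \<in> X)"
    unfolding bchoice_iff by (metis lessThan_iff)
  \<comment> \<open>One number of steps that suffices for every link at once.\<close>
  define m where "m = Suc (\<Sum>k<M. N k)"
  have m: "m > 0" "\<And>k. k < M \<Longrightarrow> N k \<le> m"
    using member_le_sum[of _ "{..<M}" N] by (auto simp: m_def intro: le_SucI)
  have "\<forall>k. \<exists>g. k < M \<longrightarrow> g 0 = p k \<and> g m = p (Suc k) \<and>
      (\<forall>i<m. \<exists>X. small_link S (W k) e' X \<and> g i \<in> X \<and> g (Suc i) \<in> X)"
    using N[OF _ m(2)] by blast
  then obtain g where g: "\<And>k. k < M \<Longrightarrow> g k 0 = p k \<and> g k m = p (Suc k) \<and>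
      (\<forall>i<m. \<exists>X. small_link S (W k) e' X \<and> g k i \<in> X \<and> g k (Suc i) \<in> X)"
    by metis
  then have "\<forall>k i. \<exists>X. k < M \<longrightarrow> i < m \<longrightarrow> small_link S (W k) e' X \<and> g k i \<in> X \<and> g k (Suc i) \<in> X"
    by metis
  then obtain X where X: "\<And>k i. k < M \<Longrightarrow> i < m \<Longrightarrow>
      small_link S (W k) e' (X k i) \<and> g k i \<in> X k i \<and> g k (Suc i) \<in> X k i"
    by metis
  define p' where "p' i = (if i < M * m then g (i div m) (i mod m) else p M)" for i
  define W' where "W' i = X (i div m) (i mod m)" for i
  have p'_end: "p' (k * m) = p k" if "k \<le> M" for k
  proof (cases "k = M")
    case True then show ?thesis by (simp add: p'_def)
  next
    case False
    then have "k * m < M * m" using that m(1) by simp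
    then show ?thesis using g[of k] m(1) that False by (simp add: p'_def)
  qed
  have p'_Suc: "p' (Suc i) = g (i div m) (Suc (i mod m))" if i: "i < M * m" for i
  proof (cases "Suc (i mod m) = m")
    case True
    have "Suc i = Suc (i div m) * m"
      using True by (metis add_Suc_right div_mult_mod_eq mult_Suc add.commute)
    moreover have "i div m < M" using i m(1) by (simp add: less_mult_imp_div_less)
    ultimately show ?thesis using p'_end[of "Suc (i div m)"] g[of "i div m"] True by auto
  next
    case False
    then have lt: "Suc (i mod m) < m" using m(1) by (metis Suc_lessI mod_less_divisor)
    then have *: "Suc i div m = i div m" "Suc i mod m = Suc (i mod m)"
      by (auto simp: div_Suc mod_Suc)
    have "Suc i < M * m"
    proof (rule ccontr)
      assume "\<not> Suc i < M * m" then have "Suc i = M * m" using i by simp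
      then show False using *(2) by simp
    qed
    then show ?thesis by (simp add: p'_def *)
  qed
  have "link_chain S V e' (M * m, p', W')"
    unfolding link_chain_def
  proof (clarify, intro conjI allI impI)
    show "0 < M * m" using c(1) m(1) by simp
    fix k assume k: "k < M * m"
    have kk: "k div m < M" "k mod m < m" using k m(1) by (auto simp: less_mult_imp_div_less)
    note * = X[OF kk]
    show "openin (top_of_set S) (W' k)" "connected (W' k)" "p' k \<in> W' k" "p' (Suc k) \<in> W' k"
      using * p'_Suc[OF k] k by (auto simp: small_link_def W'_def p'_def)
    show "closure (W' k) \<subseteq> V"
      using * c(2)[OF kk(1)] closure_subset unfolding small_link_def W'_def by blast
    show "\<forall>u\<in>W' k. \<forall>v\<in>W' k. dist u v \<le> e'"
      using * unfolding small_link_def W'_def by blast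
  qed
  moreover have "refines (M, p, W) (M * m, p', W')"
    unfolding refines_def
  proof (clarify, intro exI[of _ m] conjI allI impI)
    fix i assume "i < M * m"
    then have kk: "i div m < M" "i mod m < m" using m(1) by (auto simp: less_mult_imp_div_less)
    then show "W' i \<subseteq> W (i div m)"
      using X[OF kk] closure_subset unfolding small_link_def W'_def by blast
  qed (use m p'_end in auto)
  ultimately show ?thesis by blast
qed

text \<open>
  Refine a chain of links from \<open>x\<close> to \<open>y\<close> again and again, halving the diameters. For a parameter \<open>t\<close> the links
  over the cells that contain \<open>t\<close> are nested with diameters tending to 0, so they determine a point \<open>\<gamma> t\<close> by
  completeness. Parameters closer than \<open>1 / M n\<close> lie in the same cell or in neighbouring cells at stage \<open>n\<close>, whose
  links share a point; hence \<open>\<gamma>\<close> is continuous.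
\<close>

theorem path_connected_if_locally_connected:
  fixes S :: "'a::complete_space set"
  assumes S: "closed S" "locally connected S" and V: "openin (top_of_set S) V" "connected V"
  shows "path_connected V"
  unfolding path_connected_def
proof (intro ballI)
  fix x y assume xy: "x \<in> V" "y \<in> V"
  let ?e = "\<lambda>n::nat. (1/2::real) ^ n"
  obtain N where N: "\<And>n. N \<le> n \<Longrightarrow> \<exists>g. g 0 = x \<and> g n = y \<and> (\<forall>i<n. \<exists>W. small_link S V 1 W \<and> g i \<in> W \<and> g (Suc i) \<in> W)"
    using small_link_chain[OF S V xy zero_less_one] by auto
  obtain g where g: "g 0 = x" "g (Suc N) = y"
      "\<forall>i<Suc N. \<exists>W. small_link S V 1 W \<and> g i \<in> W \<and> g (Suc i) \<in> W"
    using N[of "Suc N"] by auto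
  then have "\<forall>i. \<exists>W. i < Suc N \<longrightarrow> small_link S V 1 W \<and> g i \<in> W \<and> g (Suc i) \<in> W" by blast
  then obtain W0 where W0: "\<And>i. i < Suc N \<Longrightarrow> small_link S V 1 (W0 i) \<and> g i \<in> W0 i \<and> g (Suc i) \<in> W0 i"
    by metis
  have c0: "link_chain S V (?e 0) (Suc N, g, W0)"
    using W0 unfolding link_chain_def small_link_def by auto
  let ?P = "\<lambda>n c. link_chain S V (?e n) c \<and> fst (snd c) 0 = x \<and> fst (snd c) (fst c) = y"
  have "\<exists>c. \<forall>n. ?P n (c n) \<and> refines (c n) (c (Suc n))"
  proof (rule dependent_nat_choice[of ?P "\<lambda>n. refines"])
    show "\<exists>c. ?P 0 c" using c0 g by (intro exI[of _ "(Suc N, g, W0)"]) auto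
    fix c :: "nat \<times> (nat \<Rightarrow> 'a) \<times> (nat \<Rightarrow> 'a set)" and n assume "?P n c"
    moreover obtain M p W where "c = (M, p, W)" by (cases c)
    ultimately have cc: "link_chain S V (?e n) (M, p, W)" "p 0 = x" "p M = y" by auto
    obtain c' where c': "link_chain S V (?e (Suc n)) c'" "refines (M, p, W) c'"
      using link_chain_refine[OF S _ cc(1)] by (metis half_gt_zero_iff power_eq_0_iff zero_less_one zero_less_power)
    obtain M' p' W' where "c' = (M', p', W')" by (cases c')
    then obtain m where "M' = M * m" "\<And>k. k \<le> M \<Longrightarrow> p' (k * m) = p k"
      using c'(2) unfolding refines_def by auto
    from this(1) this(2)[of 0] this(2)[of M] have "p' 0 = x \<and> p' M' = y" using cc by simp
    then show "\<exists>c'. ?P (Suc n) c' \<and> refines c c'"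
      using c' \<open>c' = (M', p', W')\<close> \<open>c = (M, p, W)\<close> by (intro exI[of _ c']) auto
  qed
  then obtain c where c: "\<And>n. ?P n (c n)" "\<And>n. refines (c n) (c (Suc n))" by blast
  define M where "M n = fst (c n)" for n
  define p where "p n = fst (snd (c n))" for n
  define W where "W n = snd (snd (c n))" for n
  have ceq: "c n = (M n, p n, W n)" for n by (simp add: M_def p_def W_def)
  have M0: "M n > 0" and W: "\<And>k. k < M n \<Longrightarrow> p n k \<in> W n k \<and> p n (Suc k) \<in> W n k \<and> closure (W n k) \<subseteq> V
      \<and> (\<forall>u\<in>W n k. \<forall>v\<in>W n k. dist u v \<le> ?e n)" for n
    using c(1)[of n] unfolding ceq link_chain_def by auto
  have px: "p n 0 = x" and py: "p n (M n) = y" for n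
    using c(1)[of n] unfolding ceq by auto
  have "\<forall>n. \<exists>m>0. M (Suc n) = M n * m \<and> (\<forall>i<M (Suc n). W (Suc n) i \<subseteq> W n (i div m))"
    using c(2) unfolding ceq refines_def prod.case by blast
  then obtain m where m: "\<And>n. m n > 0" "\<And>n. M (Suc n) = M n * m n"
     "\<And>n i. i < M (Suc n) \<Longrightarrow> W (Suc n) i \<subseteq> W n (i div m n)" by metis
  \<comment> \<open>The left end of the cell of \<open>t\<close> at stage \<open>n\<close>; for \<open>t = 1\<close> it is the last grid point \<open>M n\<close>, which has no cell.\<close>
  define idx where "idx n t = nat \<lfloor>t * real (M n)\<rfloor>" for n and t :: real
  have idx_less: "idx n t < M n" if "0 \<le> t" "t < 1" for n t
    using that M0[of n] unfolding idx_def by (simp add: nat_less_iff floor_less_iff)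
  have idx_Suc: "idx (Suc n) t div m n = idx n t" if "0 \<le> t" for n t
  proof -
    have "\<lfloor>t * real (M n)\<rfloor> = \<lfloor>t * real (M (Suc n)) / real (m n)\<rfloor>"
      using m(1)[of n] by (simp add: m(2))
    also have "\<dots> = \<lfloor>t * real (M (Suc n))\<rfloor> div int (m n)"
      using floor_divide_real_eq_div[of "int (m n)" "t * real (M (Suc n))"] by simp
    finally show ?thesis using that unfolding idx_def by (simp add: nat_div_distrib)
  qed
  have nest: "W (n + k) (idx (n + k) t) \<subseteq> W n (idx n t)" if "0 \<le> t" "t < 1" for n k t
  proof (induction k)
    case (Suc k)
    then show ?case using m(3)[OF idx_less[OF that, of "Suc (n+k)"]] idx_Suc[OF that(1), of "n+k"] by auto
  qed simp
  define q where "q t n = p n (idx n t)" for t n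
  have q_in: "q t (n + k) \<in> W n (idx n t)" if "0 \<le> t" "t < 1" for n k t
    using nest[OF that, of n k] W[OF idx_less[OF that]] unfolding q_def by blast
  have idx1: "idx n 1 = M n" for n by (simp add: idx_def)
  have q_dist: "dist (q t i) (q t n) \<le> ?e n" if "0 \<le> t" "t \<le> 1" "n \<le> i" for t n i
  proof (cases "t = 1")
    case True then show ?thesis by (simp add: q_def idx1 py)
  next
    case False
    with that have t: "0 \<le> t" "t < 1" by auto
    show ?thesis using q_in[OF t, of n 0] q_in[OF t, of n "i - n"] W[OF idx_less[OF t]] that by auto
  qed
  have small: "\<exists>n. ?e n < \<epsilon>" if "\<epsilon> > 0" for \<epsilon> :: real
    using that real_arch_pow_inv by force
  have "Cauchy (q t)" if "0 \<le> t" "t \<le> 1" for t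
    unfolding Cauchy_altdef2
  proof (intro allI impI)
    fix \<epsilon> :: real assume "\<epsilon> > 0"
    then obtain n where "?e n < \<epsilon>" using small by blast
    then show "\<exists>N. \<forall>n\<ge>N. dist (q t n) (q t N) < \<epsilon>"
      using q_dist[OF that] by (meson le_less_trans)
  qed
  then have "\<forall>t. \<exists>l. 0 \<le> t \<and> t \<le> 1 \<longrightarrow> q t \<longlonglongrightarrow> l" using Cauchy_convergent convergent_def by blast
  then obtain \<gamma> where \<gamma>: "\<And>t. 0 \<le> t \<Longrightarrow> t \<le> 1 \<Longrightarrow> q t \<longlonglongrightarrow> \<gamma> t" by metis
  have \<gamma>_dist: "dist (\<gamma> t) (q t n) \<le> ?e n" if "0 \<le> t" "t \<le> 1" for t n
    by (rule tendsto_upperbound[OF tendsto_dist[OF \<gamma>[OF that] tendsto_const]])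
      (use q_dist[OF that] in \<open>auto simp: eventually_sequentially\<close>)
  have \<gamma>0: "\<gamma> 0 = x"
    using \<gamma>[of 0] by (simp add: q_def[abs_def] idx_def px LIMSEQ_const_iff)
  have \<gamma>1: "\<gamma> 1 = y"
    using \<gamma>[of 1] by (simp add: q_def[abs_def] idx1 py LIMSEQ_const_iff)
  have \<gamma>V: "\<gamma> t \<in> V" if "0 \<le> t" "t \<le> 1" for t
  proof (cases "t = 1")
    case False
    with that have t: "0 \<le> t" "t < 1" by auto
    have "\<gamma> t \<in> closure (W 0 (idx 0 t))"
      using \<gamma>[OF that] q_in[OF t, of 0] unfolding closure_sequential by auto
    then show ?thesis using W[OF idx_less[OF t]] by blast
  qed (simp add: \<gamma>1 xy)
  have p_step: "dist (p n k) (p n (Suc k)) \<le> ?e n" if "k < M n" for n k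
    using W[OF that] by blast
  have idx_le: "idx n t \<le> M n" if "0 \<le> t" "t \<le> 1" for n t
    using idx_less[of t n] idx1[of n] that by (cases "t = 1") auto
  have close: "dist (\<gamma> s) (\<gamma> t) \<le> 3 * ?e n"
    if "0 \<le> s" "s \<le> t" "t \<le> 1" "t - s < 1 / real (M n)" for s t n
  proof -
    have "(t - s) * real (M n) < 1" using that(4) M0[of n] by (simp add: pos_less_divide_eq)
    then have "t * real (M n) < s * real (M n) + 1" by (simp add: algebra_simps)
    moreover have "s * real (M n) \<le> t * real (M n)" using that by (simp add: mult_right_mono)
    ultimately have "\<lfloor>t * real (M n)\<rfloor> = \<lfloor>s * real (M n)\<rfloor> \<or> \<lfloor>t * real (M n)\<rfloor> = \<lfloor>s * real (M n)\<rfloor> + 1"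
      by linarith
    then have "idx n t = idx n s \<or> idx n t = Suc (idx n s)"
      using that unfolding idx_def by (auto simp: nat_add_distrib)
    then have "dist (q s n) (q t n) \<le> ?e n"
      using p_step[of "idx n s" n] idx_le[of t n] that unfolding q_def by auto
    moreover have "dist (\<gamma> s) (q s n) \<le> ?e n" "dist (\<gamma> t) (q t n) \<le> ?e n"
      using \<gamma>_dist that by auto
    ultimately show ?thesis
      using dist_triangle[of "\<gamma> s" "\<gamma> t" "q s n"] dist_triangle2[of "q s n" "\<gamma> t" "q t n"] by linarith
  qed
  have "continuous_on {0..1} \<gamma>"
    unfolding continuous_on_iff
  proof (intro ballI allI impI)
    fix t \<epsilon> :: real assume t: "t \<in> {0..1}" and "\<epsilon> > 0"
    then obtain n where n: "?e n < \<epsilon> / 3" using small[of "\<epsilon>/3"] by auto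
    show "\<exists>d>0. \<forall>s\<in>{0..1}. dist s t < d \<longrightarrow> dist (\<gamma> s) (\<gamma> t) < \<epsilon>"
    proof (intro exI[of _ "1 / real (M n)"] conjI ballI impI)
      fix s :: real assume s: "s \<in> {0..1}" "dist s t < 1 / real (M n)"
      have "dist (\<gamma> s) (\<gamma> t) \<le> 3 * ?e n"
        using close[of s t n] close[of t s n] s t by (cases "s \<le> t") (auto simp: dist_real_def dist_commute)
      then show "dist (\<gamma> s) (\<gamma> t) < \<epsilon>" using n by linarith
    qed (use M0 in auto)
  qed
  then show "\<exists>g. path g \<and> path_image g \<subseteq> V \<and> pathstart g = x \<and> pathfinish g = y"
    using \<gamma>0 \<gamma>1 \<gamma>V by (intro exI[of _ \<gamma>]) (auto simp: path_def path_image_def pathstart_def pathfinish_def)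
qed

section \<open>Nonnegative functions with closed graph\<close>

text \<open>
  Otherwise some sequence \<open>y n\<close> tends to \<open>x\<close> with bounded values that stay away from \<open>f x\<close>, and a limit point of
  these values contradicts closedness of the graph.
\<close>

lemma closed_graph_near:
  fixes f :: "'a::metric_space \<Rightarrow> real"
  assumes nonneg: "\<And>x. 0 \<le> f x" and cl: "closed (graph_of f)" and e: "0 < e"
  obtains d where "d > 0" "\<And>y. dist x y < d \<Longrightarrow> K < f y \<or> \<bar>f y - f x\<bar> < e"
proof (rule ccontr)
  assume "\<not> thesis"
  then have "\<exists>y. dist x y < 1 / real (Suc n) \<and> f y \<le> K \<and> e \<le> \<bar>f y - f x\<bar>" for n
    using that[of "1 / real (Suc n)"] by (force simp: not_less)
  then obtain y where y: "\<And>n. dist x (y n) < 1 / real (Suc n)" "\<And>n. f (y n) \<le> K" "\<And>n. e \<le> \<bar>f (y n) - f x\<bar>"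
    by metis
  have ylim: "y \<longlonglongrightarrow> x"
  proof (rule metric_LIMSEQ_I)
    fix r :: real assume "r > 0"
    then obtain N where "1 / real (Suc N) < r" using reals_Archimedean by (auto simp: inverse_eq_divide)
    then have "dist (y n) x < r" if "n \<ge> N" for n
      using y(1)[of n] that frac_le[of 1 1 "real (Suc N)" "real (Suc n)"] by (simp add: dist_commute)
    then show "\<exists>N. \<forall>n\<ge>N. dist (y n) x < r" by blast
  qed
  have fy: "\<forall>n. f (y n) \<in> {0..K}" using y(2) nonneg by auto
  have "seq_compact {0..K}" by (simp add: compact_imp_seq_compact)
  then have "\<exists>l\<in>{0..K}. \<exists>\<rho>. strict_mono \<rho> \<and> ((\<lambda>n. f (y n)) \<circ> \<rho>) \<longlonglongrightarrow> l"
    unfolding seq_compact_def using fy by (elim allE[of _ "\<lambda>n. f (y n)"]) auto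
  then obtain l \<rho> where l: "strict_mono \<rho>" "(\<lambda>n. f (y (\<rho> n))) \<longlonglongrightarrow> l"
    unfolding o_def by blast
  have in_G: "(y (\<rho> n), f (y (\<rho> n))) \<in> graph_of f" for n by (auto simp: graph_of_def)
  have "(\<lambda>n. (y (\<rho> n), f (y (\<rho> n)))) \<longlonglongrightarrow> (x, l)"
    using LIMSEQ_subseq_LIMSEQ[OF ylim l(1)] l(2) by (intro tendsto_Pair) (auto simp: o_def)
  then have "(x, l) \<in> graph_of f" by (rule closed_sequentially[OF cl in_G])
  then have "l = f x" by (auto simp: graph_of_def)
  moreover have "e \<le> \<bar>l - f x\<bar>"
    by (rule tendsto_lowerbound[OF tendsto_rabs[OF tendsto_diff[OF l(2) tendsto_const]]])
       (use y(3) in auto)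
  ultimately show False using e by simp
qed

lemma connected_graph_local_const:
  fixes f :: "'a::metric_space \<Rightarrow> real"
  assumes conn: "connected ((\<lambda>x. (x, f x)) ` S)" and ab: "a \<in> S" "b \<in> S"
    and loc: "\<And>x. x \<in> S \<Longrightarrow> \<exists>d>0. \<forall>y\<in>S. dist x y < d \<and> \<bar>f y - f x\<bar> < d \<longrightarrow> Q y = Q x"
  shows "Q a = Q b"
proof -
  have "Q (fst (a, f a)) = Q (fst (b, f b))"
  proof (rule connected_local_const[OF conn, where f = "\<lambda>w. Q (fst w)"])
    show "\<forall>w\<in>(\<lambda>x. (x, f x)) ` S. \<forall>\<^sub>F v in at w within (\<lambda>x. (x, f x)) ` S. Q (fst w) = Q (fst v)"
    proof
      fix w assume "w \<in> (\<lambda>x. (x, f x)) ` S"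
      then obtain x where x: "x \<in> S" "w = (x, f x)" by blast
      obtain d where d: "d > 0" "\<And>y. y \<in> S \<Longrightarrow> dist x y < d \<Longrightarrow> \<bar>f y - f x\<bar> < d \<Longrightarrow> Q y = Q x"
        using loc[OF x(1)] by blast
      have "Q x = Q y" if "y \<in> S" "dist (y, f y) (x, f x) < d" for y
        using d(2)[OF that(1)] dist_fst_le[of "(y, f y)" "(x, f x)"] dist_snd_le[of "(y, f y)" "(x, f x)"] that(2)
        by (auto simp: dist_real_def dist_commute)
      then show "\<forall>\<^sub>F v in at w within (\<lambda>x. (x, f x)) ` S. Q (fst w) = Q (fst v)"
        unfolding eventually_at x(2) using d(1) by (intro exI[of _ d]) auto
    qed
  qed (use ab in auto)
  then show ?thesis by simp
qed

section \<open>Closed Jordan domains\<close>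

text \<open>
  The boundary curve leaves a small ball around \<open>t\<close> only along a subarc \<open>L2\<close> that avoids \<open>t\<close>. Points \<open>u\<close>, \<open>v\<close> of the
  interior very close to \<open>t\<close> are separated neither by the whole curve nor by \<open>L2\<close> together with the sphere
  of radius \<open>e\<close>. These two closed sets meet in the connected set \<open>L2\<close>, so by Janiszewski's theorem their union does not
  separate \<open>u\<close> and \<open>v\<close> either.
\<close>

lemma inside_Jordan_locally_connected_at_boundary:
  fixes g :: "real \<Rightarrow> complex"
  assumes g: "simple_path g" "pathfinish g = pathstart g" and t: "t \<in> path_image g" and e: "0 < e"
  obtains d where "d > 0"
    "\<And>u v. \<lbrakk>u \<in> inside (path_image g) \<inter> ball t d; v \<in> inside (path_image g) \<inter> ball t d\<rbrakk>
       \<Longrightarrow> connected_component (inside (path_image g) \<inter> ball t e) u v"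
proof -
  obtain a where a: "0 \<le> a" "a \<le> 1" "g a = t" using t by (auto simp: path_image_def)
  define h where "h = shiftpath a g"
  define L where "L = path_image g"
  have h: "simple_path h" "path_image h = L" "h 0 = t" "h 1 = t"
    using simple_path_shiftpath[OF g a(1,2)] path_image_shiftpath[OF _ g(2), of a] a
      pathstart_shiftpath[of a g] pathfinish_shiftpath[of a g] g(2)
    unfolding h_def L_def by (auto simp: pathstart_def pathfinish_def)
  have conth: "continuous_on {0..1} h" using h(1) by (simp add: simple_path_def path_def)
  obtain d0 where d0: "d0 > 0" "\<And>x. x \<in> {0..1} \<Longrightarrow> dist x 0 < d0 \<Longrightarrow> dist (h x) t < e"
    using conth e h(3) unfolding continuous_on_iff by (metis atLeastAtMost_iff order_refl zero_le_one)
  obtain d1 where d1: "d1 > 0" "\<And>x. x \<in> {0..1} \<Longrightarrow> dist x 1 < d1 \<Longrightarrow> dist (h x) t < e"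
    using conth e h(4) unfolding continuous_on_iff by (metis atLeastAtMost_iff order_refl zero_le_one)
  define \<eta> where "\<eta> = min (1/2) (min d0 d1)"
  have \<eta>: "0 < \<eta>" "\<eta> \<le> 1/2" "\<eta> \<le> d0" "\<eta> \<le> d1" using d0 d1 by (auto simp: \<eta>_def)
  define L2 where "L2 = h ` {\<eta>..1-\<eta>}"
  have sub: "{\<eta>..1-\<eta>} \<subseteq> {0..1}" using \<eta> by auto
  have L2: "compact L2" "connected L2"
    unfolding L2_def using continuous_on_subset[OF conth sub]
    by (auto intro: compact_continuous_image connected_continuous_image)
  have L2L: "L2 \<subseteq> L" using h(2) sub unfolding L2_def path_image_def by blast
  have near: "x \<in> ball t e" if "x \<in> L" "x \<notin> L2" for x
  proof -
    obtain b where b: "b \<in> {0..1}" "x = h b" using \<open>x \<in> L\<close> h(2) unfolding path_image_def by blast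
    then have "b < \<eta> \<or> b > 1 - \<eta>" using \<open>x \<notin> L2\<close> unfolding L2_def by (meson atLeastAtMost_iff image_eqI not_le)
    then show ?thesis using d0(2)[of b] d1(2)[of b] b \<eta> by (auto simp: dist_real_def dist_commute)
  qed
  have "t \<notin> L2"
  proof
    assume "t \<in> L2"
    then obtain b where b: "b \<in> {\<eta>..1-\<eta>}" "h b = h 0" using h(3) unfolding L2_def by force
    then have "b = 0 \<or> b = 1"
      using h(1) \<eta> unfolding simple_path_def loop_free_def by (metis atLeastAtMost_iff order_refl sub subsetD zero_le_one)
    then show False using b \<eta> by auto
  qed
  then obtain d' where d': "d' > 0" "\<And>x. x \<in> L2 \<Longrightarrow> d' \<le> dist t x"
    using separate_point_closed[OF compact_imp_closed[OF L2(1)]] by blast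
  define d where "d = min d' e"
  have d: "d > 0" "d \<le> e" "ball t d \<inter> L2 = {}" using d' e by (force simp: d_def)+
  note Jio = Jordan_inside_outside[OF g, folded L_def]
  have "connected_component (inside L \<inter> ball t e) u v"
    if uv: "u \<in> inside L \<inter> ball t d" "v \<in> inside L \<inter> ball t d" for u v
  proof -
    have compL: "compact L" unfolding L_def using g by (simp add: compact_simple_path_image)
    have "L \<inter> (L2 \<union> sphere t e) = L2" using near L2L by fastforce
    then have conn: "connected (L \<inter> (L2 \<union> sphere t e))" using L2 by simp
    have c1: "connected_component (- L) u v"
      unfolding connected_component_def using Jio uv inside_no_overlap[of L] by (intro exI[of _ "inside L"]) blast
    have "ball t d \<subseteq> - (L2 \<union> sphere t e)" using d by auto
    then have c2: "connected_component (- (L2 \<union> sphere t e)) u v"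
      unfolding connected_component_def using uv by (intro exI[of _ "ball t d"]) (auto simp del: mem_ball)
    have "connected_component (- (L \<union> (L2 \<union> sphere t e))) u v"
      by (rule Janiszewski[OF compL _ conn c1 c2]) (simp add: L2(1) compact_imp_closed closed_Un)
    then obtain C where C: "connected C" "C \<subseteq> - (L \<union> (L2 \<union> sphere t e))" "u \<in> C" "v \<in> C"
      unfolding connected_component_def by blast
    have "C \<subseteq> inside L"
    proof
      fix z assume "z \<in> C"
      then have "connected_component (- L) u z"
        using C unfolding connected_component_def by blast
      then show "z \<in> inside L" using uv by (metis IntD1 inside_same_component)
    qed
    moreover have "C \<subseteq> ball t e"
    proof (rule ccontr)
      assume "\<not> C \<subseteq> ball t e"
      then obtain z where "z \<in> C" "z \<notin> ball t e" by blast
      moreover have "C \<subseteq> ball t e \<union> (- cball t e)" using C(2) by auto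
      moreover have "u \<in> ball t e" using uv d by auto
      moreover have "ball t e \<inter> - cball t e \<inter> C = {}" by auto
      ultimately show False
        using connectedD[OF C(1), of "ball t e" "- cball t e"] C(3) open_Compl[OF closed_cball] by blast
    qed
    ultimately show ?thesis using C unfolding connected_component_def by blast
  qed
  then show ?thesis using that[OF d(1)] unfolding L_def by blast
qed

lemma log_unique_on_connected:
  fixes S :: "complex set"
  assumes "continuous_on S a" "continuous_on S b" "\<And>z. z \<in> S \<Longrightarrow> exp (a z) = exp (b z)" "connected S"
  shows "\<exists>k. \<forall>z\<in>S. a z = b z + (k::complex)"
proof -
  have "(\<lambda>z. a z - b z) constant_on S"
  proof (rule continuous_discrete_range_constant[OF assms(4)])
    show "continuous_on S (\<lambda>z. a z - b z)" using assms by (intro continuous_intros)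
    fix x assume x: "x \<in> S"
    show "\<exists>e>0. \<forall>y. y \<in> S \<and> a y - b y \<noteq> a x - b x \<longrightarrow> e \<le> norm (a y - b y - (a x - b x))"
    proof (intro exI[of _ 1] conjI allI impI)
      fix y assume y: "y \<in> S \<and> a y - b y \<noteq> a x - b x"
      have "exp (a y - b y - (a x - b x)) = 1" using assms(3)[of x] assms(3)[of y] x y by (simp add: exp_diff)
      then obtain n :: int where n: "Re (a y - b y - (a x - b x)) = 0"
          "Im (a y - b y - (a x - b x)) = of_int (2 * n) * pi"
        unfolding exp_eq_1 by blast
      then have "n \<noteq> 0" using y by (auto simp: complex_eq_iff)
      then have "1 \<le> \<bar>real_of_int n\<bar>" by linarith
      then have "1 * 1 \<le> (2 * \<bar>real_of_int n\<bar>) * pi" using pi_gt3 by (intro mult_mono) auto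
      also have "\<dots> = \<bar>Im (a y - b y - (a x - b x))\<bar>" unfolding n(2) by (simp add: abs_mult)
      also have "\<dots> \<le> norm (a y - b y - (a x - b x))" by (rule abs_Im_le_cmod)
      finally show "1 \<le> norm (a y - b y - (a x - b x))" by simp
    qed simp
  qed
  then obtain k where "\<And>z. z \<in> S \<Longrightarrow> a z - b z = k" unfolding constant_on_def by blast
  then show ?thesis by (intro exI[of _ k]) (auto simp: algebra_simps)
qed

text \<open>
  The interior is simply connected, so a logarithm exists there. At a boundary point off \<open>P\<close> it
  differs from a local logarithm by a constant, because the interior is locally connected at the boundary; so it
  extends continuously. The set \<open>P\<close> may meet the boundary, where \<open>\<theta>\<close> need not be continuous.
\<close>

lemma continuous_log_on_closed_Jordan_domain:
  fixes g :: "real \<Rightarrow> complex"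
  assumes g: "simple_path g" "pathfinish g = pathstart g"
    and P: "closed P" "inside (path_image g) \<inter> P = {}"
    and \<theta>: "continuous_on (- P) \<theta>" "\<And>z. z \<in> - P \<Longrightarrow> \<theta> z \<noteq> (0::complex)"
  obtains \<tau> where "continuous_on (inside (path_image g) \<union> path_image g - P) \<tau>"
    "\<And>z. z \<in> inside (path_image g) \<union> path_image g - P \<Longrightarrow> \<theta> z = exp (\<tau> z)"
proof -
  define L where "L = path_image g"
  define R where "R = inside L"
  note Jio = Jordan_inside_outside[OF g, folded L_def R_def]
  have RP: "R \<subseteq> - P" using P by (auto simp: R_def L_def)
  have LR: "L \<subseteq> closure R" using Jio by (auto simp: frontier_def)
  obtain T where T: "continuous_on R T" "\<And>z. z \<in> R \<Longrightarrow> \<theta> z = exp (T z)"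
  proof (rule continuous_logarithm_on_simply_connected)
    show "continuous_on R \<theta>" using \<theta>(1) RP continuous_on_subset by blast
    show "simply_connected R" unfolding R_def L_def by (rule simply_connected_inside_simple_path[OF g(1)])
    show "locally path_connected R" using Jio by (simp add: open_imp_locally_path_connected)
  qed (use \<theta>(2) RP in auto)
  have loc: "\<exists>d \<phi>. d > 0 \<and> continuous_on (ball t d) \<phi> \<and> (\<forall>y\<in>ball t d. \<theta> y = exp (\<phi> y)) \<and> (\<forall>y\<in>R \<inter> ball t d. T y = \<phi> y)"
    if t: "t \<in> L - P" for t
  proof -
    obtain e where e: "e > 0" "ball t e \<subseteq> - P" using P(1) t open_contains_ball[of "- P"] by auto
    obtain \<phi> where \<phi>: "continuous_on (ball t e) \<phi>" "\<And>z. z \<in> ball t e \<Longrightarrow> \<theta> z = exp (\<phi> z)"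
      using continuous_logarithm_on_ball[of t e \<theta>] continuous_on_subset[OF \<theta>(1) e(2)] \<theta>(2) e(2) by blast
    obtain d where d: "d > 0" "\<And>u v. \<lbrakk>u \<in> R \<inter> ball t d; v \<in> R \<inter> ball t d\<rbrakk>
       \<Longrightarrow> connected_component (R \<inter> ball t e) u v"
      using inside_Jordan_locally_connected_at_boundary[OF g _ e(1), of t] t unfolding R_def L_def by blast
    define d' where "d' = min d e"
    have d': "d' > 0" "ball t d' \<subseteq> ball t d" "ball t d' \<subseteq> ball t e" using d e by (auto simp: d'_def)
    have "\<exists>k. \<forall>y\<in>R \<inter> ball t d. y \<in> ball t e \<longrightarrow> T y = \<phi> y + k"
    proof (cases "R \<inter> ball t d = {}")
      case False
      then obtain u where u: "u \<in> R \<inter> ball t d" by blast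
      define k where "k = T u - \<phi> u"
      have "T y = \<phi> y + k" if y: "y \<in> R \<inter> ball t d" "y \<in> ball t e" for y
      proof -
        obtain C where C: "connected C" "C \<subseteq> R \<inter> ball t e" "u \<in> C" "y \<in> C"
          using d(2)[OF u y(1)] unfolding connected_component_def by blast
        have "\<exists>k. \<forall>z\<in>C. T z = \<phi> z + k"
        proof (rule log_unique_on_connected[OF _ _ _ C(1)])
          show "exp (T z) = exp (\<phi> z)" if "z \<in> C" for z
            using that C(2) T(2)[of z] \<phi>(2)[of z] by (metis IntD1 IntD2 subsetD)
        qed (use C(2) T \<phi> continuous_on_subset in blast)+
        then show ?thesis using C(3,4) by (auto simp: k_def)
      qed
      then show ?thesis by blast
    qed simp
    then obtain k where k: "\<And>y. y \<in> R \<inter> ball t d' \<Longrightarrow> T y = \<phi> y + k" using d' by blast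
    have "t \<in> closure R" using t LR by blast
    then obtain w where w: "w \<in> R" "w \<in> ball t d'"
      using d'(1) closure_approachable[of t R] by (auto simp: dist_commute)
    have "exp k = 1"
    proof -
      have "exp (\<phi> w + k) = exp (\<phi> w)" using k[of w] T(2)[of w] \<phi>(2)[of w] w d' by (metis Int_iff subsetD)
      then show ?thesis by (simp add: exp_add)
    qed
    then show ?thesis
      using k d' \<phi> continuous_on_subset[OF \<phi>(1) d'(3)]
      by (intro exI[of _ d'] exI[of _ "\<lambda>y. \<phi> y + k"]) (auto intro!: continuous_intros simp: exp_add)
  qed
  then obtain d \<phi> where d\<phi>: "\<And>t. t \<in> L - P \<Longrightarrow> d t > 0 \<and> continuous_on (ball t (d t)) (\<phi> t)
      \<and> (\<forall>y\<in>ball t (d t). \<theta> y = exp (\<phi> t y)) \<and> (\<forall>y\<in>R \<inter> ball t (d t). T y = \<phi> t y)"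
    by metis
  define \<tau> where "\<tau> z = (if z \<in> R then T z else \<phi> z z)" for z
  have \<tau>\<phi>: "\<tau> y = \<phi> t y" if t: "t \<in> L - P" and y: "y \<in> R \<union> L - P" "y \<in> ball t (d t)" for t y
  proof (cases "y \<in> R")
    case True then show ?thesis using d\<phi>[OF t] y by (auto simp: \<tau>_def)
  next
    case False
    then have yL: "y \<in> L - P" using y by auto
    have ev: "\<forall>\<^sub>F z in at y within R. \<phi> t z = \<phi> y z"
    proof -
      have "open (ball t (d t) \<inter> ball y (d y))" "y \<in> ball t (d t) \<inter> ball y (d y)"
        using y d\<phi>[OF yL] by auto
      then show ?thesis unfolding eventually_at_topological using d\<phi>[OF t] d\<phi>[OF yL] by (metis IntD1 IntD2 IntI)
    qed
    have nt: "at y within R \<noteq> bot"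
      using yL LR False trivial_limit_within[of y R] by (auto simp: closure_def)
    have i1: "isCont (\<phi> t) y" using d\<phi>[OF t] y by (simp add: continuous_on_eq_continuous_at)
    have i2: "isCont (\<phi> y) y" using d\<phi>[OF yL] by (simp add: continuous_on_eq_continuous_at)
    have "(\<phi> t \<longlongrightarrow> \<phi> t y) (at y within R)" "(\<phi> y \<longlongrightarrow> \<phi> y y) (at y within R)"
      using i1 i2 by (auto simp: isCont_def intro: tendsto_within_subset)
    then have "\<phi> t y = \<phi> y y"
      using tendsto_unique[OF nt] tendsto_cong[OF ev] by blast
    then show ?thesis using False by (simp add: \<tau>_def)
  qed
  have "continuous_on (R \<union> L - P) \<tau>"
    unfolding continuous_on_eq_continuous_within
  proof
    fix t assume t: "t \<in> R \<union> L - P"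
    have "\<exists>U \<psi>. open U \<and> t \<in> U \<and> isCont \<psi> t \<and> (\<forall>y\<in>(R \<union> L - P) \<inter> U. \<tau> y = \<psi> y)"
    proof (cases "t \<in> R")
      case True
      then have "isCont T t" using T(1) Jio by (simp add: continuous_on_eq_continuous_at)
      then show ?thesis using True Jio by (intro exI[of _ R] exI[of _ T]) (auto simp: \<tau>_def)
    next
      case False
      then have tL: "t \<in> L - P" using t by auto
      then have "isCont (\<phi> t) t" using d\<phi>[OF tL] by (simp add: continuous_on_eq_continuous_at)
      then show ?thesis using d\<phi>[OF tL] \<tau>\<phi>[OF tL] by (intro exI[of _ "ball t (d t)"] exI[of _ "\<phi> t"]) auto
    qed
    then obtain U \<psi> where U: "open U" "t \<in> U" "isCont \<psi> t" "\<And>y. y \<in> (R \<union> L - P) \<inter> U \<Longrightarrow> \<tau> y = \<psi> y" by blast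
    have "(\<psi> \<longlongrightarrow> \<psi> t) (at t within (R \<union> L - P))"
      using U(3) by (auto simp: isCont_def intro: tendsto_within_subset)
    moreover have "\<forall>\<^sub>F y in at t within (R \<union> L - P). \<psi> y = \<tau> y"
      unfolding eventually_at_topological using U by (metis IntI)
    ultimately have "(\<tau> \<longlongrightarrow> \<psi> t) (at t within (R \<union> L - P))" by (simp add: tendsto_cong)
    then show "continuous (at t within R \<union> L - P) \<tau>" using U(4)[of t] U(2) t by (simp add: continuous_within)
  qed
  moreover have "\<theta> z = exp (\<tau> z)" if "z \<in> R \<union> L - P" for z
  proof (cases "z \<in> R")
    case True then show ?thesis using T by (simp add: \<tau>_def)
  next
    case False
    then have zL: "z \<in> L - P" using that by auto
    then show ?thesis using d\<phi>[OF zL] False by (simp add: \<tau>_def)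
  qed
  ultimately show ?thesis using that unfolding R_def L_def by blast
qed

text \<open>
  The unbounded connected set \<open>outside (path_image g)\<close> misses the curve \<open>h\<close>, so it lies outside \<open>h\<close>. Points of the
  curve \<open>g\<close> are limits of it, so they cannot lie in the open inside of \<open>h\<close>.
\<close>

lemma inside_Jordan_mono:
  fixes g h :: "real \<Rightarrow> complex"
  assumes g: "simple_path g" "pathfinish g = pathstart g"
    and h: "simple_path h" "pathfinish h = pathstart h"
    and sub: "path_image h \<subseteq> inside (path_image g) \<union> path_image g"
  shows "inside (path_image h) \<subseteq> inside (path_image g)"
proof -
  note Jg = Jordan_inside_outside[OF g]
  note Jh = Jordan_inside_outside[OF h]
  have out: "outside (path_image g) \<subseteq> - path_image h"
    using sub inside_Int_outside[of "path_image g"] outside_no_overlap[of "path_image g"] by blast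
  have "outside (path_image g) \<subseteq> outside (path_image h)"
  proof
    fix z assume z: "z \<in> outside (path_image g)"
    then have "outside (path_image g) \<subseteq> connected_component_set (- path_image h) z"
      using Jg out by (intro connected_component_maximal) auto
    then have "\<not> bounded (connected_component_set (- path_image h) z)"
      using Jg bounded_subset by blast
    then show "z \<in> outside (path_image h)" using z out by (auto simp: outside_def)
  qed
  then have disj: "inside (path_image h) \<inter> outside (path_image g) = {}"
    using inside_Int_outside[of "path_image h"] by blast
  show ?thesis
  proof
    fix y assume y: "y \<in> inside (path_image h)"
    have "y \<notin> path_image g"
    proof
      assume "y \<in> path_image g"
      then have "y \<in> closure (outside (path_image g))" using Jg by (auto simp: frontier_def)
      then show False using disj y Jh by (metis disjoint_iff open_Int_closure_eq_empty)
    qed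
    moreover have "y \<notin> outside (path_image g)" using disj y by blast
    ultimately show "y \<in> inside (path_image g)" using inside_Un_outside[of "path_image g"] by blast
  qed
qed

section \<open>Finitely many components and finitely many values\<close>

lemma finite_isolating_radius:
  fixes P :: "'a::metric_space set"
  assumes "finite P"
  obtains r where "r > 0" "\<And>p q. p \<in> P \<Longrightarrow> q \<in> P \<Longrightarrow> dist p q \<le> r \<Longrightarrow> p = q"
proof -
  have "\<exists>d>0. \<forall>q\<in>P. q \<noteq> p \<longrightarrow> d \<le> dist p q" for p
    using finite_set_avoid[OF assms] by blast
  then obtain d where d: "\<And>p. d p > 0" "\<And>p q. q \<in> P \<Longrightarrow> q \<noteq> p \<Longrightarrow> d p \<le> dist p q" by metis
  define m where "m = Min (insert 1 (d ` P))"
  define r where "r = m / 2"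
  have "m > 0" using assms d(1) by (auto simp: m_def)
  moreover have "m \<le> d p" if "p \<in> P" for p using assms that by (auto simp: m_def)
  ultimately have "r > 0" "\<And>p. p \<in> P \<Longrightarrow> r < d p"
    unfolding r_def by force+
  then show ?thesis using that d(2) by (metis not_le order_less_le_trans)
qed

text \<open>
  Draw disjoint small spheres around the points of \<open>P\<close>. A component \<open>K\<close> of \<open>D - P\<close> that misses all of them lies
  within one ball around some \<open>p\<close>, and then it is open and closed in the connected set \<open>D - {p}\<close>, or it stays
  away from \<open>P\<close>, and then it is open and closed in \<open>D\<close>; so it is the only component. All other components
  meet the compact union of the spheres, which finitely many of these open sets cover.
\<close>

lemma finite_components_Diff_finite:
  fixes D P :: "'a::metric_space set"
  assumes D: "compact D" "connected D" "locally connected D"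
    and nocut: "\<And>p. p \<in> D \<Longrightarrow> connected (D - {p})" and P: "finite P"
  shows "finite (components (D - P))"
proof -
  obtain r where r: "r > 0" "\<And>p q. p \<in> P \<Longrightarrow> q \<in> P \<Longrightarrow> dist p q \<le> r \<Longrightarrow> p = q"
    using finite_isolating_radius[OF P] by blast
  define S where "S = D \<inter> (\<Union>p\<in>P. sphere p r)"
  have compS: "compact S"
  proof -
    have "closed (sphere p r)" for p :: 'a
    proof -
      have "sphere p r = cball p r - ball p r" by auto
      then show ?thesis by (metis closed_Diff closed_cball open_ball)
    qed
    then show ?thesis unfolding S_def using D(1) P by (intro compact_Int_closed closed_UN) auto
  qed
  have SP: "S \<inter> P = {}" using r by (force simp: S_def)
  have oDP: "openin (top_of_set D) (D - P)"
    using P finite_imp_closed[OF P] by (simp add: openin_diff closedin_closed_Int Diff_eq openin_open_Int open_Compl)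
  have opK: "openin (top_of_set D) K" if "K \<in> components (D - P)" for K
    using openin_components_locally_connected[OF locally_open_subset[OF D(3) oDP] that] oDP openin_trans by blast
  have clK: "closure K \<inter> (D - P) \<subseteq> K" if K: "K \<in> components (D - P)" for K
  proof -
    obtain C where C: "closed C" "K = (D - P) \<inter> C"
      using closedin_component[OF K] unfolding closedin_closed by blast
    then have "closure K \<subseteq> C" by (simp add: closure_minimal)
    then show ?thesis using C by blast
  qed
  have clD: "closure K \<subseteq> D" if "K \<in> components (D - P)" for K
    using in_components_subset[OF that] D(1) by (meson Diff_subset closure_minimal compact_imp_closed order_trans)
  have single: "components (D - P) = {K}" if K: "K \<in> components (D - P)" "K \<inter> S = {}" for K
  proof -
    have KD: "K \<subseteq> D - P" "K \<noteq> {}" "connected K"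
      using K(1) in_components_subset in_components_nonempty in_components_connected by blast+
    have "D - P \<subseteq> K"
    proof (cases "\<exists>p\<in>P. K \<inter> ball p r \<noteq> {}")
      case True
      then obtain p where p: "p \<in> P" "K \<inter> ball p r \<noteq> {}" by blast
      have "K \<subseteq> ball p r"
      proof (rule ccontr)
        assume "\<not> K \<subseteq> ball p r"
        moreover have "K \<inter> sphere p r = {}" using K(2) KD(1) p(1) by (auto simp: S_def)
        then have "K \<subseteq> ball p r \<union> - cball p r" by force
        moreover have "ball p r \<inter> - cball p r \<inter> K = {}" by auto
        ultimately show False
          using connectedD[OF KD(3), of "ball p r" "- cball p r"] p(2) open_Compl[OF closed_cball] by blast
      qed
      then have "closure K \<subseteq> cball p r" by (meson ball_subset_cball closed_cball closure_minimal order_trans)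
      then have "closure K \<inter> P \<subseteq> {p}" using r(2) p(1) by force
      then have "closure K \<inter> (D - {p}) \<subseteq> K" using clK[OF K(1)] by blast
      then have "closedin (top_of_set (D - {p})) K"
        using KD(1) p(1) closure_subset[of K] unfolding closedin_closed by (intro exI[of _ "closure K"]) auto
      moreover have "openin (top_of_set (D - {p})) K"
        using opK[OF K(1)] KD(1) p(1) by (meson Diff_subset openin_subset_trans Diff_mono order_trans empty_subsetI insert_subset order_refl)
      moreover have "connected (D - {p})"
        using nocut D(2) by (cases "p \<in> D") auto
      ultimately have "K = D - {p}" using KD(2) unfolding connected_clopen by blast
      then show ?thesis using p(1) by blast
    next
      case False
      then have "closure K \<inter> P = {}"
        using r(1) by (metis centre_in_ball disjoint_iff open_Int_closure_eq_empty open_ball inf.commute)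
      then have "closure K = K" using clK[OF K(1)] clD[OF K(1)] closure_subset by blast
      then have "closedin (top_of_set D) K" using KD(1) by (metis closed_closure closed_subset Diff_subset order_trans)
      then have "K = D" using opK[OF K(1)] D(2) KD(2) unfolding connected_clopen by blast
      then show ?thesis by blast
    qed
    then have "K = D - P" using KD by blast
    then show ?thesis using KD by (metis components_eq_sing_iff)
  qed
  show ?thesis
  proof (cases "\<exists>K\<in>components (D - P). K \<inter> S = {}")
    case True
    then show ?thesis using single by (metis finite.emptyI finite.insertI)
  next
    case False
    have SD: "S \<subseteq> D" "S \<subseteq> D - P" using SP by (auto simp: S_def)
    let ?C = "(\<lambda>K. S \<inter> K) ` components (D - P)"
    have "\<forall>c\<in>?C. openin (top_of_set S) c"
    proof clarify
      fix K assume "K \<in> components (D - P)"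
      then obtain O' where "open O'" "K = D \<inter> O'" using opK openin_open by metis
      then show "openin (top_of_set S) (S \<inter> K)"
        unfolding openin_open using SD(1) by (intro exI[of _ O']) auto
    qed
    moreover have "S \<subseteq> \<Union>?C" using SD(2) Union_components[of "D - P"] by auto
    ultimately have "\<exists>F\<subseteq>?C. finite F \<and> S \<subseteq> \<Union>F"
      by (intro compS[unfolded compact_eq_openin_cover, THEN spec, THEN mp] conjI)
    then obtain F where F: "F \<subseteq> ?C" "finite F" "S \<subseteq> \<Union>F" by blast
    then obtain F' where F': "F' \<subseteq> components (D - P)" "finite F'" "F = (\<lambda>K. S \<inter> K) ` F'"
      by (meson finite_subset_image)
    have "components (D - P) \<subseteq> F'"
    proof
      fix K assume K: "K \<in> components (D - P)"
      then obtain x where x: "x \<in> K" "x \<in> S" using False by blast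
      then obtain K' where "K' \<in> F'" "x \<in> K'" using F(3) F'(3) by blast
      then show "K \<in> F'" using components_nonoverlap[OF K, of K'] F'(1) x by blast
    qed
    then show ?thesis using F'(2) finite_subset by blast
  qed
qed

lemma finite_image_locally_const_interval:
  fixes h :: "real \<Rightarrow> 'b"
  assumes "finite \<Phi>" "is_interval I"
    and "\<And>u. u \<in> I - \<Phi> \<Longrightarrow> \<exists>d>0. \<forall>v\<in>I - \<Phi>. dist u v < d \<longrightarrow> h v = h u"
  shows "finite (h ` (I - \<Phi>))"
  using assms
proof (induction \<Phi> arbitrary: I rule: finite_induct)
  case empty
  have "h a = h b" if "a \<in> I" "b \<in> I" for a b
  proof (rule connected_local_const[of I])
    show "connected I" using empty.prems(1) by (simp add: is_interval_connected)
    show "\<forall>a\<in>I. \<forall>\<^sub>F b in at a within I. h a = h b"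
      unfolding eventually_at using empty.prems(2) by (metis Diff_empty dist_commute)
  qed (use that in auto)
  then have "h ` I \<subseteq> {h a}" if "a \<in> I" for a using that by blast
  then show ?case by (metis Diff_empty finite.emptyI finite.insertI finite_subset image_is_empty equals0I)
next
  case (insert x \<Phi>)
  have sub: "finite (h ` (J - \<Phi>))" if J: "is_interval J" "J - \<Phi> \<subseteq> I - insert x \<Phi>" for J
    using insert.IH[OF J(1)] insert.prems(2) J(2) by (meson subsetD)
  have "is_interval (I \<inter> {..<x})" "is_interval (I \<inter> {x<..})"
    using insert.prems(1) by (auto intro: is_interval_Int)
  then have "finite (h ` (I \<inter> {..<x} - \<Phi>))" "finite (h ` (I \<inter> {x<..} - \<Phi>))"
    using sub by auto
  moreover have "h ` (I - insert x \<Phi>) \<subseteq> h ` (I \<inter> {..<x} - \<Phi>) \<union> h ` (I \<inter> {x<..} - \<Phi>)"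
    by force
  ultimately show ?case by (meson finite_UnI finite_subset)
qed

section \<open>A continuous phase and its integer levels\<close>

text \<open>
  The plane is taken to be the complex plane, where Jordan curves and logarithms are at home. The only
  finiteness assumption is \<open>finite_P\<close>; everything below works towards \<open>P = {}\<close>.
\<close>

locale closed_graph_plane =
  fixes f :: "complex \<Rightarrow> real" and D P :: "complex set"
  assumes nonneg: "\<And>z. 0 \<le> f z"
    and closed_graph: "closed (graph_of f)"
    and connected_graph: "connected (graph_of f)"
    and graph_locally_connected: "locally connected (graph_of f)"
    and D_eq: "D = discont_points UNIV f"
    and P_eq: "P = discont_points D f"
    and compact_D: "compact D" and connected_D: "connected D"
    and D_locally_connected: "locally connected D"
    and D_nocut: "\<And>p. p \<in> D \<Longrightarrow> connected (D - {p})"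
    and finite_P: "finite P"
begin

lemma near:
  assumes "0 < e"
  obtains d where "d > 0" "\<And>y. dist x y < d \<Longrightarrow> K < f y \<or> \<bar>f y - f x\<bar> < e"
  using closed_graph_near[OF nonneg closed_graph assms] by blast

lemma PD: "P \<subseteq> D" by (auto simp: P_eq discont_points_def)

lemma open_Compl_P: "open (- P)" using finite_P by (simp add: finite_imp_closed open_Compl)

lemma isCont_outside_D: "z \<notin> D \<Longrightarrow> isCont f z"
  by (simp add: D_eq discont_points_def)

lemma cont_on_D_minus_P: "continuous_on (D - P) f"
proof -
  have "continuous (at x within D) f" if "x \<in> D - P" for x
    using that by (auto simp: P_eq discont_points_def)
  then show ?thesis
    unfolding continuous_on_eq_continuous_within by (meson Diff_subset continuous_within_subset)
qed

lemma isCont_delta: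
  assumes "isCont h z" "0 < e"
  obtains d where "d > 0" "\<And>y. dist z y < d \<Longrightarrow> \<bar>h y - h z\<bar> < (e::real)"
  using assms unfolding continuous_at_eps_delta by (metis dist_commute dist_real_def)

lemma escape_at_D:
  assumes "x \<in> D" "0 < r"
  obtains y where "dist x y < r" "K < f y"
proof -
  have "\<not> isCont f x" using assms(1) by (simp add: D_eq discont_points_def)
  then obtain e where e: "e > 0" "\<And>d. d > 0 \<Longrightarrow> \<exists>y. dist x y < d \<and> e \<le> \<bar>f y - f x\<bar>"
    unfolding continuous_at_eps_delta dist_real_def by (metis dist_commute not_le)
  obtain d where d: "d > 0" "\<And>y. dist x y < d \<Longrightarrow> K < f y \<or> \<bar>f y - f x\<bar> < e"
    using near[OF e(1)] by blast
  obtain y where "dist x y < min d r" "e \<le> \<bar>f y - f x\<bar>" using e(2)[of "min d r"] d(1) assms(2) by auto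
  then show ?thesis using that d(2)[of y] by auto
qed

text \<open>
  With \<open>F\<close> a continuous extension of \<open>f|(D - P)\<close>, clamp \<open>f - F\<close> to \<open>[0,1]\<close>. Near a point of \<open>D - P\<close> the values of
  \<open>f - F\<close> are close to 0 or exceed 1, and the exponential takes the same value at 0 and 1. Dependence of \<open>\<kappa>\<close>
  on the point is controlled along the graph, that is, by the distance of points and of values.
\<close>

lemma phase_exists:
  obtains \<kappa> :: "complex \<Rightarrow> real" where
    "continuous_on (- P) (\<lambda>z. exp (2 * pi * \<kappa> z * \<i>))"
    "\<And>x. x \<in> D - P \<Longrightarrow> \<kappa> x = 0"
    "\<And>x e. x \<in> - P \<Longrightarrow> 0 < e \<Longrightarrow> \<exists>d>0. \<forall>y. dist x y < d \<and> \<bar>f y - f x\<bar> < d \<longrightarrow> \<bar>\<kappa> y - \<kappa> x\<bar> < e"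
    "\<And>x. x \<in> D - P \<Longrightarrow> \<exists>d>0. \<exists>K. \<forall>y. dist x y < d \<and> K < f y \<longrightarrow> \<kappa> y = 1"
proof -
  have "closedin (top_of_set (- P)) (D - P)"
    using closedin_closed_Int[of D "- P"] compact_D by (simp add: Diff_eq Int_commute[of D] compact_imp_closed)
  then obtain F where F: "continuous_on (- P) F" "\<And>x. x \<in> D - P \<Longrightarrow> F x = f x"
    using Tietze_unbounded[OF cont_on_D_minus_P] by blast
  define \<kappa> where "\<kappa> z = max 0 (min 1 (f z - F z))" for z
  have contF: "isCont F x" if "x \<in> - P" for x
    using F(1) that open_Compl_P by (simp add: continuous_on_eq_continuous_at)
  have k0: "\<kappa> x = 0" if "x \<in> D - P" for x using F(2)[OF that] by (simp add: \<kappa>_def)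
  have k_lip: "\<bar>\<kappa> y - \<kappa> x\<bar> \<le> \<bar>f y - f x\<bar> + \<bar>F y - F x\<bar>" for x y
    unfolding \<kappa>_def by linarith
  have k_near: "\<exists>d>0. \<forall>y. dist x y < d \<and> \<bar>f y - f x\<bar> < d \<longrightarrow> \<bar>\<kappa> y - \<kappa> x\<bar> < e"
    if x: "x \<in> - P" and e: "0 < e" for x e
  proof -
    obtain d where d: "d > 0" "\<And>y. dist x y < d \<Longrightarrow> \<bar>F y - F x\<bar> < e / 2"
      using isCont_delta[OF contF[OF x], of "e/2"] e by auto
    have "\<bar>\<kappa> y - \<kappa> x\<bar> < e" if "dist x y < min d (e/2)" "\<bar>f y - f x\<bar> < min d (e/2)" for y
      using that d(2)[of y] k_lip[of y x] by auto
    then show ?thesis using d(1) e by (intro exI[of _ "min d (e/2)"]) auto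
  qed
  have k_far: "\<exists>d>0. \<exists>K. \<forall>y. dist x y < d \<and> K < f y \<longrightarrow> \<kappa> y = 1" if x: "x \<in> D - P" for x
  proof -
    obtain d where d: "d > 0" "\<And>y. dist x y < d \<Longrightarrow> \<bar>F y - F x\<bar> < 1"
      using isCont_delta[OF contF, of x 1] x by auto
    have "\<kappa> y = 1" if "dist x y < d" "F x + 2 < f y" for y
      using d(2)[OF that(1)] that(2) unfolding \<kappa>_def by linarith
    then show ?thesis using d(1) by blast
  qed
  have "continuous_on (- P) (\<lambda>z. exp (2 * pi * \<kappa> z * \<i>))"
    unfolding continuous_on_eq_continuous_at[OF open_Compl_P]
  proof
    fix x assume x: "x \<in> - P"
    show "isCont (\<lambda>z. exp (2 * pi * \<kappa> z * \<i>)) x"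
    proof (cases "x \<in> D")
      case False
      then have "isCont \<kappa> x"
        unfolding \<kappa>_def using contF[OF x] isCont_outside_D by (intro continuous_intros) auto
      then show ?thesis by (intro continuous_intros) auto
    next
      case True
      then have xD: "x \<in> D - P" using x by blast
      have "isCont (\<lambda>r::real. exp (2 * pi * r * \<i>)) 0" by (intro continuous_intros)
      show ?thesis
        unfolding continuous_at_eps_delta
      proof (intro allI impI)
        fix e :: real assume "e > 0"
        obtain \<delta> where \<delta>: "\<delta> > 0" "\<And>r::real. \<bar>r\<bar> < \<delta> \<Longrightarrow> dist (exp (2 * pi * r * \<i>)) 1 < e"
          using \<open>isCont (\<lambda>r::real. exp (2 * pi * r * \<i>)) 0\<close> \<open>e > 0\<close>
          unfolding continuous_at_eps_delta by (auto simp: dist_real_def)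
        obtain d1 where d1: "d1 > 0" "\<And>y. dist x y < d1 \<Longrightarrow> \<bar>f y - f x\<bar> < d1 \<Longrightarrow> \<bar>\<kappa> y - \<kappa> x\<bar> < \<delta>"
          using k_near[OF x \<delta>(1)] by blast
        obtain d2 K where d2: "d2 > 0" "\<And>y. dist x y < d2 \<Longrightarrow> K < f y \<Longrightarrow> \<kappa> y = 1"
          using k_far[OF xD] by blast
        obtain d3 where d3: "d3 > 0" "\<And>y. dist x y < d3 \<Longrightarrow> K < f y \<or> \<bar>f y - f x\<bar> < d1"
          using near[OF d1(1)] by blast
        show "\<exists>d>0. \<forall>y. dist y x < d \<longrightarrow> dist (exp (2 * pi * \<kappa> y * \<i>)) (exp (2 * pi * \<kappa> x * \<i>)) < e"
        proof (intro exI[of _ "Min {d1, d2, d3}"] conjI allI impI)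
          fix y assume "dist y x < Min {d1, d2, d3}"
          then have y: "dist x y < d1" "dist x y < d2" "dist x y < d3" by (auto simp: dist_commute)
          show "dist (exp (2 * pi * \<kappa> y * \<i>)) (exp (2 * pi * \<kappa> x * \<i>)) < e"
          proof (cases "K < f y")
            case True
            then have "\<kappa> y = 1" using d2(2) y by blast
            then show ?thesis using k0[OF xD] \<open>e > 0\<close> by (simp add: exp_two_pi_i mult.commute)
          next
            case False
            then have "\<bar>\<kappa> y\<bar> < \<delta>" using d3(2)[OF y(3)] d1(2)[OF y(1)] k0[OF xD] by auto
            then show ?thesis using \<delta>(2) k0[OF xD] by simp
          qed
        qed (use d1 d2 d3 in auto)
      qed
    qed
  qed
  then show ?thesis using that k0 k_near k_far by blast
qed

text \<open>
  Here \<open>s = \<kappa> - \<tau>\<close> with \<open>exp (2\<pi>i\<tau>)\<close> the phase and \<open>\<tau>\<close> continuous. It is an integer that varies continuously along the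
  graph. From \<open>x \<in> D\<close> to nearby points with large values, \<open>\<kappa>\<close> grows from 0 to 1 while \<open>\<tau>\<close> hardly changes.
\<close>

lemma level_exists:
  assumes g: "simple_path g" "pathfinish g = pathstart g" and PR: "inside (path_image g) \<inter> P = {}"
  defines "Y \<equiv> inside (path_image g) \<union> path_image g - P"
  obtains s :: "complex \<Rightarrow> int" where
    "\<And>x. x \<in> Y \<Longrightarrow> \<exists>d>0. \<forall>y\<in>Y. dist x y < d \<and> \<bar>f y - f x\<bar> < d \<longrightarrow> s y = s x"
    "\<And>x. x \<in> D \<inter> inside (path_image g) \<Longrightarrow> \<exists>y\<in>inside (path_image g). s y = s x + 1"
proof -
  define R where "R = inside (path_image g)"
  have RY: "R \<subseteq> Y" using PR by (auto simp: R_def Y_def)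
  have YP: "Y \<subseteq> - P" by (auto simp: Y_def)
  have openR: "open R" using Jordan_inside_outside[OF g] by (simp add: R_def)
  obtain \<kappa> :: "complex \<Rightarrow> real" where \<kappa>:
    "continuous_on (- P) (\<lambda>z. exp (2 * pi * \<kappa> z * \<i>))"
    "\<And>x. x \<in> D - P \<Longrightarrow> \<kappa> x = 0"
    "\<And>x e. x \<in> - P \<Longrightarrow> 0 < e \<Longrightarrow> \<exists>d>0. \<forall>y. dist x y < d \<and> \<bar>f y - f x\<bar> < d \<longrightarrow> \<bar>\<kappa> y - \<kappa> x\<bar> < e"
    "\<And>x. x \<in> D - P \<Longrightarrow> \<exists>d>0. \<exists>K. \<forall>y. dist x y < d \<and> K < f y \<longrightarrow> \<kappa> y = 1"
    using phase_exists by blast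
  obtain \<tau> where \<tau>: "continuous_on Y \<tau>" "\<And>z. z \<in> Y \<Longrightarrow> exp (2 * pi * \<kappa> z * \<i>) = exp (\<tau> z)"
    using continuous_log_on_closed_Jordan_domain[OF g _ PR \<kappa>(1)] finite_P
    unfolding Y_def by (auto simp: finite_imp_closed)
  define t where "t z = Im (\<tau> z) / (2 * pi)" for z
  have contt: "continuous_on Y t"
    unfolding t_def using \<tau>(1) by (intro continuous_intros) auto
  have "\<exists>n::int. \<kappa> z - t z = of_int n" if z: "z \<in> Y" for z
  proof -
    obtain n :: int where "2 * pi * \<kappa> z * \<i> = \<tau> z + (of_int (2 * n) * pi) * \<i>"
      using \<tau>(2)[OF z] unfolding exp_eq by blast
    then have "2 * pi * \<kappa> z = Im (\<tau> z) + 2 * n * pi"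
      by (auto simp: complex_eq_iff)
    then have "\<kappa> z - t z = of_int n" by (simp add: t_def field_simps)
    then show ?thesis by blast
  qed
  then obtain s :: "complex \<Rightarrow> int" where s: "\<And>z. z \<in> Y \<Longrightarrow> \<kappa> z - t z = of_int (s z)" by metis
  have t_near: "\<exists>d>0. \<forall>y\<in>Y. dist x y < d \<longrightarrow> \<bar>t y - t x\<bar> < 1/2" if "x \<in> Y" for x
    using contt that unfolding continuous_on_iff dist_real_def
    by (metis dist_commute half_gt_zero_iff zero_less_one)
  have A: "\<exists>d>0. \<forall>y\<in>Y. dist x y < d \<and> \<bar>f y - f x\<bar> < d \<longrightarrow> s y = s x" if x: "x \<in> Y" for x
  proof -
    obtain d1 where d1: "d1 > 0" "\<And>y. y \<in> Y \<Longrightarrow> dist x y < d1 \<Longrightarrow> \<bar>t y - t x\<bar> < 1/2"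
      using t_near[OF x] by blast
    obtain d2 where d2: "d2 > 0" "\<And>y. dist x y < d2 \<Longrightarrow> \<bar>f y - f x\<bar> < d2 \<Longrightarrow> \<bar>\<kappa> y - \<kappa> x\<bar> < 1/2"
      using \<kappa>(3)[of x "1/2"] x YP by auto
    have "s y = s x" if y: "y \<in> Y" "dist x y < min d1 d2" "\<bar>f y - f x\<bar> < min d1 d2" for y
      using s[OF y(1)] s[OF x] d1(2)[OF y(1)] d2(2)[of y] y(2,3) by linarith
    then show ?thesis using d1(1) d2(1) by (intro exI[of _ "min d1 d2"]) auto
  qed
  have B: "\<exists>y\<in>R. s y = s x + 1" if x: "x \<in> D \<inter> R" for x
  proof -
    have xY: "x \<in> Y" "x \<in> D - P" using x RY YP by auto
    obtain d1 where d1: "d1 > 0" "\<And>y. y \<in> Y \<Longrightarrow> dist x y < d1 \<Longrightarrow> \<bar>t y - t x\<bar> < 1/2"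
      using t_near[OF xY(1)] by blast
    obtain d2 K where d2: "d2 > 0" "\<And>y. dist x y < d2 \<Longrightarrow> K < f y \<Longrightarrow> \<kappa> y = 1"
      using \<kappa>(4)[OF xY(2)] by blast
    obtain d3 where d3: "d3 > 0" "ball x d3 \<subseteq> R" using openR x open_contains_ball by blast
    obtain y where y: "dist x y < Min {d1, d2, d3}" "K < f y"
      using escape_at_D[of x "Min {d1, d2, d3}"] x d1 d2 d3 by auto
    then have yR: "y \<in> R" using d3 by auto
    then have "\<kappa> y = 1" "\<bar>t y - t x\<bar> < 1/2" using y d2(2) d1(2) RY by auto
    moreover have "- t x = of_int (s x)" "\<kappa> y - t y = of_int (s y)"
      using s[OF xY(1)] s[of y] yR RY \<kappa>(2)[OF xY(2)] by auto
    ultimately have "s y = s x + 1" by linarith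
    then show ?thesis using yR by blast
  qed
  show ?thesis using that A B unfolding R_def by blast
qed

section \<open>Every jump loop encloses a discontinuity\<close>

text \<open>
  A typical jump loop leaves \<open>p\<close> along an arc of bounded values and returns along an arc on which \<open>f\<close> tends to
  infinity. The graph over it is a path that starts at \<open>(p, f p)\<close> and never comes back.
\<close>

definition jump_loop :: "(real \<Rightarrow> complex) \<Rightarrow> complex \<Rightarrow> bool"
  where "jump_loop g p \<longleftrightarrow> simple_path g \<and> pathfinish g = pathstart g \<and> p \<in> path_image g \<inter> P
     \<and> continuous_on (path_image g - {p}) f \<and> path_connected ((\<lambda>z. (z, f z)) ` path_image g)
     \<and> \<not> continuous (at p within path_image g) f"

text \<open>
  If no point of \<open>P\<close> is enclosed, the level function \<open>s\<close> exists on the closed Jordan domain without \<open>P\<close>, and a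
  level \<open>c\<close> that \<open>s\<close> takes inside the loop but never on \<open>D\<close> cuts the graph of \<open>f\<close> into two pieces.
\<close>

lemma jump_loop_encloses_P:
  assumes loop: "jump_loop g p"
  shows "inside (path_image g) \<inter> P \<noteq> {}"
proof
  assume PR: "inside (path_image g) \<inter> P = {}"
  define L where "L = path_image g"
  define R where "R = inside L"
  define Y where "Y = R \<union> L - P"
  have g: "simple_path g" "pathfinish g = pathstart g" and p: "p \<in> L" "p \<in> P"
    and contL: "continuous_on (L - {p}) f" and pcL: "path_connected ((\<lambda>z. (z, f z)) ` L)"
    and jump: "\<not> continuous (at p within L) f"
    using loop unfolding jump_loop_def L_def by auto
  note Jio = Jordan_inside_outside[OF g, folded L_def, folded R_def]
  have openR: "open R" and LR: "L \<subseteq> closure R" and neR: "R \<noteq> {}" and RL: "R \<inter> L = {}"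
    using Jio inside_no_overlap[of L] by (auto simp: frontier_def R_def)
  have compL: "compact L" unfolding L_def using g by (simp add: compact_simple_path_image)
  have clRL: "closed (R \<union> L)"
    using closed_path_image_Un_inside simple_path_imp_path[OF g(1)] unfolding R_def L_def by (metis Un_commute)
  have away: "\<exists>d>0. \<forall>y. dist a y < d \<longrightarrow> y \<notin> R \<union> L" if "a \<notin> R \<union> L" for a
  proof -
    have "open (- (R \<union> L))" "a \<in> - (R \<union> L)" using open_Compl[OF clRL] that by auto
    then obtain d where "d > 0" "ball a d \<subseteq> - (R \<union> L)" by (rule openE)
    then show ?thesis by (intro exI[of _ d]) (metis ComplD mem_ball subsetD)
  qed
  have RY: "R \<subseteq> Y" using PR by (auto simp: R_def L_def Y_def)
  have pick: "\<exists>y\<in>R. dist t y < d" if "t \<in> L" "d > 0" for t d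
    using LR that closure_approachable[of t R] by (metis dist_commute subsetD)
  obtain s :: "complex \<Rightarrow> int" where
    sY: "\<And>x. x \<in> Y \<Longrightarrow> \<exists>d>0. \<forall>y\<in>Y. dist x y < d \<and> \<bar>f y - f x\<bar> < d \<longrightarrow> s y = s x"
    and sD: "\<And>x. x \<in> D \<inter> R \<Longrightarrow> \<exists>y\<in>R. s y = s x + 1"
    using level_exists[OF g PR] unfolding R_def L_def Y_def by metis
  have sDY: "\<exists>d>0. \<forall>y\<in>D \<inter> Y. dist x y < d \<longrightarrow> s y = s x" if x: "x \<in> D \<inter> Y" for x
  proof -
    obtain d where d: "d > 0" "\<And>y. y \<in> Y \<Longrightarrow> dist x y < d \<Longrightarrow> \<bar>f y - f x\<bar> < d \<Longrightarrow> s y = s x"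
      using sY x by blast
    have "x \<in> D - P" using x by (auto simp: Y_def)
    then obtain d' where "d' > 0" "\<And>y. y \<in> D - P \<Longrightarrow> dist x y < d' \<Longrightarrow> \<bar>f y - f x\<bar> < d"
      using cont_on_D_minus_P d(1) unfolding continuous_on_iff dist_real_def by (metis dist_commute)
    then show ?thesis using d by (intro exI[of _ "min d d'"]) (auto simp: Y_def)
  qed

  \<comment> \<open>\<open>f\<close> is continuous along the loop off \<open>P\<close>, hence \<open>s\<close> is constant on each of the finitely many arcs left by \<open>P\<close>.\<close>
  have finL: "finite (s ` (L - P))"
  proof -
    let ?h = "\<lambda>u. s (g u)"
    define \<Phi> where "\<Phi> = g -` P \<inter> {0<..<1}"
    have "inj_on g {0<..<1}" using g(1) by (simp add: simple_path_def loop_free_inj_on)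
    then have fin\<Phi>: "finite \<Phi>" unfolding \<Phi>_def using finite_P finite_vimage_IntI by blast
    have "\<exists>d>0. \<forall>v\<in>{0<..<1} - \<Phi>. dist u v < d \<longrightarrow> ?h v = ?h u" if u: "u \<in> {0<..<1} - \<Phi>" for u
    proof -
      have gY: "g v \<in> Y" "g v \<in> L - {p}" if "v \<in> {0<..<1} - \<Phi>" for v
        using that p(2) unfolding \<Phi>_def Y_def L_def path_image_def by auto
      have contg: "continuous_on ({0<..<1} - \<Phi>) g"
        using g(1) unfolding simple_path_def path_def by (rule continuous_on_subset[OF conjunct1]) auto
      have contfg: "continuous_on ({0<..<1} - \<Phi>) (\<lambda>v. f (g v))"
        by (rule continuous_on_compose2[OF contL contg]) (intro image_subsetI gY(2))
      obtain d where d: "d > 0" "\<And>y. y \<in> Y \<Longrightarrow> dist (g u) y < d \<Longrightarrow> \<bar>f y - f (g u)\<bar> < d \<Longrightarrow> s y = s (g u)"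
        using sY[OF gY(1)[OF u]] by blast
      obtain d1 where d1: "d1 > 0" "\<And>v. v \<in> {0<..<1} - \<Phi> \<Longrightarrow> dist v u \<le> d1 \<Longrightarrow> dist (g v) (g u) < d"
        by (rule continuous_onE[OF contg u d(1)]) (rule that)
      obtain d2 where d2: "d2 > 0" "\<And>v. v \<in> {0<..<1} - \<Phi> \<Longrightarrow> dist v u \<le> d2 \<Longrightarrow> dist (f (g v)) (f (g u)) < d"
        by (rule continuous_onE[OF contfg u d(1)]) (rule that)
      have "?h v = ?h u" if v: "v \<in> {0<..<1} - \<Phi>" "dist u v < min d1 d2" for v
        using d(2)[OF gY(1)[OF v(1)]] d1(2)[OF v(1)] d2(2)[OF v(1)] v(2) by (auto simp: dist_commute dist_real_def)
      then show ?thesis using d1(1) d2(1) by (intro exI[of _ "min d1 d2"]) auto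
    qed
    then have "finite (?h ` ({0<..<1} - \<Phi>))"
      by (intro finite_image_locally_const_interval[OF fin\<Phi>]) auto
    moreover have "s ` (L - P) \<subseteq> ?h ` ({0<..<1} - \<Phi>) \<union> {?h 0, ?h 1}"
    proof
      fix c assume "c \<in> s ` (L - P)"
      then obtain u where "u \<in> {0..1}" "g u \<notin> P" "c = ?h u" unfolding L_def path_image_def by blast
      then show "c \<in> ?h ` ({0<..<1} - \<Phi>) \<union> {?h 0, ?h 1}"
        by (cases "u = 0 \<or> u = 1") (auto simp: \<Phi>_def)
    qed
    ultimately show ?thesis by (meson finite.emptyI finite.insertI finite_UnI finite_subset)
  qed

  \<comment> \<open>If \<open>c\<close> is not a value on the loop, the points of \<open>D\<close> inside the loop with level \<open>c\<close> form a union of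
      components of \<open>D - P\<close>. So \<open>c\<close> can be read off from any point of such a component.\<close>
  have finD: "finite (s ` (D \<inter> R))"
  proof -
    let ?m = "\<lambda>K. s (SOME y. y \<in> K)"
    have "s ` (D \<inter> R) - s ` (L - P) \<subseteq> ?m ` components (D - P)"
    proof
      fix c assume c: "c \<in> s ` (D \<inter> R) - s ` (L - P)"
      then obtain x where x: "x \<in> D \<inter> R" "s x = c" by blast
      then have "x \<in> D - P" using RY by (auto simp: Y_def)
      then obtain K where K: "K \<in> components (D - P)" "x \<in> K"
        using Union_components[of "D - P"] by blast
      define E where "E y \<longleftrightarrow> y \<in> R \<and> s y = c" for y
      have "E x = E y" if y: "y \<in> K" for y
      proof (rule connected_local_const[OF in_components_connected[OF K(1)] K(2) y])
        show "\<forall>a\<in>K. \<forall>\<^sub>F b in at a within K. E a = E b"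
        proof
          fix a assume "a \<in> K"
          have KD: "K \<subseteq> D - P" using in_components_subset[OF K(1)] .
          have "\<exists>d>0. \<forall>b\<in>K. dist a b < d \<longrightarrow> E a = E b"
          proof (cases "a \<in> R \<union> L")
            case False
            then show ?thesis using away[OF False] by (auto simp: E_def)
          next
            case True
            then have aY: "a \<in> D \<inter> Y" using \<open>a \<in> K\<close> KD by (auto simp: Y_def)
            obtain d where d: "d > 0" "\<And>y. y \<in> D \<inter> Y \<Longrightarrow> dist a y < d \<Longrightarrow> s y = s a"
              using sDY[OF aY] by blast
            show ?thesis
            proof (cases "a \<in> R")
              case True
              then obtain d' where d': "d' > 0" "ball a d' \<subseteq> R" using openR open_contains_ball by blast
              have "E a = E b" if b: "b \<in> K" "dist a b < min d d'" for b
              proof -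
                have "b \<in> R" using b d' by auto
                moreover have "s b = s a" using d(2)[of b] b KD RY \<open>b \<in> R\<close> by auto
                ultimately show ?thesis using True by (simp add: E_def)
              qed
              then show ?thesis using d d' by (intro exI[of _ "min d d'"]) auto
            next
              case False
              then have "a \<in> L - P" using True aY by (auto simp: Y_def)
              then have "s a \<noteq> c" using c by blast
              have "E a = E b" if b: "b \<in> K" "dist a b < d" for b
                using d(2)[of b] b subsetD[OF KD, of b] subsetD[OF RY, of b] \<open>s a \<noteq> c\<close> False
                by (auto simp: E_def)
              then show ?thesis using d(1) by blast
            qed
          qed
          then show "\<forall>\<^sub>F b in at a within K. E a = E b" unfolding eventually_at by (metis dist_commute)
        qed
      qed
      moreover have "E x" using x by (simp add: E_def)
      ultimately have "E (SOME y. y \<in> K)" using K(2) by (metis someI)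
      then show "c \<in> ?m ` components (D - P)" using K(1) by (auto simp: E_def)
    qed
    then have "finite (s ` (D \<inter> R) - s ` (L - P))"
      using finite_components_Diff_finite[OF compact_D connected_D D_locally_connected D_nocut finite_P]
      by (meson finite_imageI finite_subset)
    then show ?thesis using finL by (metis finite_Diff2)
  qed

  \<comment> \<open>The level above the highest one on \<open>D\<close> is attained, since \<open>s\<close> increases by 1 near every point of \<open>D\<close>.\<close>
  obtain c where c: "c \<in> s ` R" "c \<notin> s ` (D \<inter> R)"
  proof (cases "D \<inter> R = {}")
    case True then show ?thesis using neR that by blast
  next
    case False
    then have "Max (s ` (D \<inter> R)) \<in> s ` (D \<inter> R)" using finD by (intro Max_in) auto
    then obtain x where x: "x \<in> D \<inter> R" "s x = Max (s ` (D \<inter> R))" by auto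
    then obtain y where y: "y \<in> R" "s y = Max (s ` (D \<inter> R)) + 1" using sD by metis
    moreover have "s y \<notin> s ` (D \<inter> R)" using Max_ge[OF finD, of "s y"] y(2) by auto
    ultimately show ?thesis using that by blast
  qed
  define Z where "Z = {y \<in> R. s y = c}"
  have ZD: "Z \<inter> D = {}" using c(2) by (auto simp: Z_def)
  have sRloc: "\<exists>d>0. \<forall>y. dist x y < d \<and> \<bar>f y - f x\<bar> < d \<longrightarrow> y \<in> R \<and> s y = s x" if x: "x \<in> R" for x
  proof -
    obtain d where d: "d > 0" "\<And>y. y \<in> Y \<Longrightarrow> dist x y < d \<Longrightarrow> \<bar>f y - f x\<bar> < d \<Longrightarrow> s y = s x"
      using sY x RY by blast
    obtain d' where d': "d' > 0" "ball x d' \<subseteq> R" using openR x open_contains_ball by blast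
    have *: "y \<in> R \<and> s y = s x" if y: "dist x y < min d d'" "\<bar>f y - f x\<bar> < min d d'" for y
    proof -
      have "y \<in> R" using d'(2) y(1) by auto
      then show ?thesis using d(2)[of y] RY y by auto
    qed
    have "min d d' > 0" using d(1) d'(1) by simp
    then show ?thesis using * by blast
  qed

  \<comment> \<open>A boundary point is good if, seen from inside, the level is constantly \<open>c\<close> near it and \<open>f\<close> is bounded. The
      set of points of level \<open>c\<close> with value below \<open>f t + 1\<close> is open and closed in the part of \<open>R\<close> near \<open>t\<close>; as this part is locally connected
      at \<open>t\<close>, a point that is not good has no such points nearby.\<close>
  define good where "good t \<longleftrightarrow> (\<exists>d>0. \<forall>y\<in>R. dist t y < d \<longrightarrow> y \<in> Z \<and> f y < f t + 1)" for t
  have dich: "\<exists>d>0. \<forall>y\<in>R. dist t y < d \<longrightarrow> \<not> (y \<in> Z \<and> f y < f t + 1)" if t: "t \<in> L" "\<not> good t" for t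
  proof -
    obtain r where r: "r > 0" "\<And>y. dist t y < r \<Longrightarrow> f t + 2 < f y \<or> \<bar>f y - f t\<bar> < 1"
      using near[OF zero_less_one, of t "f t + 2"] by blast
    obtain d where d: "d > 0" "\<And>u v. \<lbrakk>u \<in> R \<inter> ball t d; v \<in> R \<inter> ball t d\<rbrakk>
       \<Longrightarrow> connected_component (R \<inter> ball t r) u v"
      using inside_Jordan_locally_connected_at_boundary[OF g _ r(1), of t] t(1) unfolding R_def L_def by blast
    define A where "A y \<longleftrightarrow> y \<in> Z \<and> f y < f t + 1" for y
    have "A u = A v" if uv: "u \<in> R \<inter> ball t d" "v \<in> R \<inter> ball t d" for u v
    proof -
      obtain C where C: "connected C" "C \<subseteq> R \<inter> ball t r" "u \<in> C" "v \<in> C"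
        using d(2)[OF uv] unfolding connected_component_def by blast
      show ?thesis
      proof (rule connected_local_const[OF C(1,3,4)])
        show "\<forall>a\<in>C. \<forall>\<^sub>F b in at a within C. A a = A b"
        proof
          fix a assume aC: "a \<in> C"
          then have a: "a \<in> R" "dist t a < r" using C(2) by auto
          obtain d1 where d1: "d1 > 0" "\<And>y. dist a y < d1 \<Longrightarrow> \<bar>f y - f a\<bar> < d1 \<Longrightarrow> y \<in> R \<and> s y = s a"
            using sRloc[OF a(1)] by blast
          have "\<exists>d>0. \<forall>b\<in>C. dist a b < d \<longrightarrow> A a = A b"
          proof (cases "A a")
            case True
            then have "isCont f a" using ZD isCont_outside_D by (auto simp: A_def)
            moreover define e where "e = min d1 (f t + 1 - f a)"
            moreover have "e > 0" using True d1(1) by (simp add: e_def A_def)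
            ultimately obtain d2 where d2: "d2 > 0" "\<And>y. dist a y < d2 \<Longrightarrow> \<bar>f y - f a\<bar> < e"
              using isCont_delta by blast
            have "A b" if b: "dist a b < min d1 d2" for b
              using d1(2)[of b] d2(2)[of b] b True by (auto simp: A_def Z_def e_def)
            then show ?thesis using d1(1) d2(1) True by (intro exI[of _ "min d1 d2"]) auto
          next
            case False
            obtain d2 where d2: "d2 > 0" "\<And>y. dist a y < d2 \<Longrightarrow> f t + 1 < f y \<or> \<bar>f y - f a\<bar> < min 1 d1"
              using near[of "min 1 d1" a "f t + 1"] d1(1) by auto
            have "\<not> A b" if b: "dist a b < min d1 d2" for b
            proof
              assume Ab: "A b"
              then have *: "\<bar>f b - f a\<bar> < min 1 d1" using d2(2)[of b] b by (auto simp: A_def)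
              then have "s b = s a" using d1(2)[of b] b by auto
              moreover have "f a < f t + 2" using * Ab by (auto simp: A_def)
              then have "f a < f t + 1" using r(2)[OF a(2)] by auto
              ultimately have "A a" using Ab a(1) by (auto simp: A_def Z_def)
              then show False using False by blast
            qed
            then show ?thesis using d1(1) d2(1) False by (intro exI[of _ "min d1 d2"]) auto
          qed
          then show "\<forall>\<^sub>F b in at a within C. A a = A b" unfolding eventually_at by (metis dist_commute)
        qed
      qed
    qed
    then have "(\<forall>y\<in>R \<inter> ball t d. A y) \<or> (\<forall>y\<in>R \<inter> ball t d. \<not> A y)" by blast
    then have "(\<forall>y\<in>R. dist t y < d \<longrightarrow> A y) \<or> (\<forall>y\<in>R. dist t y < d \<longrightarrow> \<not> A y)"
      unfolding Int_iff Ball_def mem_ball by blast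
    moreover have "\<not> (\<forall>y\<in>R. dist t y < d \<longrightarrow> A y)" using t(2) d(1) unfolding good_def A_def by blast
    ultimately show ?thesis using d(1) unfolding A_def by blast
  qed

  have good_const: "good a = good b" if ab: "a \<in> L" "b \<in> L" for a b
  proof (rule connected_graph_local_const[OF path_connected_imp_connected[OF pcL] ab, where Q = good])
    fix t assume t: "t \<in> L"
    show "\<exists>d>0. \<forall>y\<in>L. dist t y < d \<and> \<bar>f y - f t\<bar> < d \<longrightarrow> good y = good t"
    proof (cases "good t")
      case True
      then obtain d where d: "d > 0" "\<And>y. y \<in> R \<Longrightarrow> dist t y < d \<Longrightarrow> y \<in> Z \<and> f y < f t + 1"
        unfolding good_def by blast
      have "good t'" if t': "dist t t' < d" for t'
      proof -
        obtain r where r: "r > 0" "\<And>y. dist t' y < r \<Longrightarrow> f t + 1 < f y \<or> \<bar>f y - f t'\<bar> < 1"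
          using near[OF zero_less_one, of t' "f t + 1"] by blast
        have "y \<in> Z \<and> f y < f t' + 1" if y: "y \<in> R" "dist t' y < min r (d - dist t t')" for y
        proof -
          have "dist t y < d" using dist_triangle[of t y t'] y(2) by auto
          then show ?thesis using d(2)[OF y(1)] r(2)[of y] y(2) by auto
        qed
        then show ?thesis unfolding good_def using r(1) t' by (intro exI[of _ "min r (d - dist t t')"]) auto
      qed
      then show ?thesis using d(1) True by blast
    next
      case False
      then obtain d where d: "d > 0" "\<And>y. y \<in> R \<Longrightarrow> dist t y < d \<Longrightarrow> \<not> (y \<in> Z \<and> f y < f t + 1)"
        using dich[OF t] by blast
      have "\<not> good t'" if t': "t' \<in> L" "dist t t' < min d (1/2)" "\<bar>f t' - f t\<bar> < min d (1/2)" for t'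
      proof
        assume "good t'"
        then obtain d1 where d1: "d1 > 0" "\<And>y. y \<in> R \<Longrightarrow> dist t' y < d1 \<Longrightarrow> y \<in> Z \<and> f y < f t' + 1"
          unfolding good_def by blast
        obtain r where r: "r > 0" "\<And>y. dist t' y < r \<Longrightarrow> f t' + 1 < f y \<or> \<bar>f y - f t'\<bar> < 1/2"
          using near[of "1/2" t' "f t' + 1"] by auto
        obtain y where y: "y \<in> R" "dist t' y < Min {d1, r, d - dist t t'}"
          using pick[OF t'(1), of "Min {d1, r, d - dist t t'}"] d1 r t' by auto
        then have "y \<in> Z" "f y < f t' + 1" "\<bar>f y - f t'\<bar> < 1/2" using d1(2)[OF y(1)] r(2)[of y] by auto
        moreover have "dist t y < d" using dist_triangle[of t y t'] y(2) by auto
        ultimately show False using d(2)[OF y(1)] t'(3) by auto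
      qed
      then show ?thesis using d(1) False by (intro exI[of _ "min d (1/2)"]) auto
    qed
  qed
  \<comment> \<open>If all points of the loop were good, \<open>f\<close> would be bounded near \<open>p\<close> from inside, hence along the
      loop, which its jump at \<open>p\<close> excludes.\<close>
  have not_good: "\<not> good t0" if t0: "t0 \<in> L" for t0
  proof
    assume "good t0"
    then have all: "good t" if "t \<in> L" for t using good_const[OF t0 that] by blast
    obtain d where d: "d > 0" "\<And>y. y \<in> R \<Longrightarrow> dist p y < d \<Longrightarrow> f y < f p + 1"
      using all[OF p(1)] unfolding good_def by blast
    obtain e where e: "e > 0" "\<And>d. d > 0 \<Longrightarrow> \<exists>t\<in>L. dist p t < d \<and> e \<le> \<bar>f t - f p\<bar>"
      using jump unfolding continuous_within_eps_delta dist_real_def by (metis dist_commute not_le)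
    obtain r where r: "r > 0" "\<And>y. dist p y < r \<Longrightarrow> f p + 3 < f y \<or> \<bar>f y - f p\<bar> < e"
      using near[OF e(1), of p "f p + 3"] by blast
    obtain u where u: "u \<in> L" "dist p u < min r d" "e \<le> \<bar>f u - f p\<bar>"
      using e(2)[of "min r d"] r d by auto
    then have fu: "f p + 3 < f u" using r(2)[of u] by auto
    obtain d1 where d1: "d1 > 0" "\<And>y. y \<in> R \<Longrightarrow> dist u y < d1 \<Longrightarrow> f y < f u + 1"
      using all[OF u(1)] unfolding good_def by blast
    obtain r1 where r1: "r1 > 0" "\<And>y. dist u y < r1 \<Longrightarrow> f u + 1 < f y \<or> \<bar>f y - f u\<bar> < 1"
      using near[OF zero_less_one, of u "f u + 1"] by blast
    obtain y where y: "y \<in> R" "dist u y < Min {d1, r1, d - dist p u}"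
      using pick[OF u(1), of "Min {d1, r1, d - dist p u}"] d1 r1 u by auto
    then have "\<bar>f y - f u\<bar> < 1" using d1(2)[OF y(1)] r1(2)[of y] by auto
    moreover have "dist p y < d" using dist_triangle[of p y u] y(2) by auto
    ultimately show False using d(2)[OF y(1)] fu by auto
  qed

  \<comment> \<open>Without good boundary points, \<open>Z\<close> is open and closed along the whole graph of \<open>f\<close>, but does not contain \<open>p\<close>.\<close>
  obtain z where z: "z \<in> Z" using c(1) by (auto simp: Z_def)
  have graph_eq: "graph_of f = (\<lambda>x. (x, f x)) ` UNIV" by (auto simp: graph_of_def)
  have "(z \<in> Z) = (p \<in> Z)"
  proof (rule connected_graph_local_const[OF connected_graph[unfolded graph_eq], where Q = "\<lambda>y. y \<in> Z"])
    fix x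
    show "\<exists>d>0. \<forall>y\<in>UNIV. dist x y < d \<and> \<bar>f y - f x\<bar> < d \<longrightarrow> (y \<in> Z) = (x \<in> Z)"
    proof (cases "x \<in> R")
      case True
      obtain d where "d > 0" "\<And>y. dist x y < d \<Longrightarrow> \<bar>f y - f x\<bar> < d \<Longrightarrow> y \<in> R \<and> s y = s x"
        using sRloc[OF True] by blast
      then show ?thesis unfolding Z_def mem_Collect_eq using True by metis
    next
      case xR: False
      show ?thesis
      proof (cases "x \<in> L")
        case True
        then obtain d where d: "d > 0" "\<And>y. y \<in> R \<Longrightarrow> dist x y < d \<Longrightarrow> \<not> (y \<in> Z \<and> f y < f x + 1)"
          using dich[OF True not_good[OF True]] by blast
        have "y \<notin> Z" if "dist x y < min d 1" "\<bar>f y - f x\<bar> < min d 1" for y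
          using d(2)[of y] that by (auto simp: Z_def)
        then show ?thesis using d(1) xR by (intro exI[of _ "min d 1"]) (auto simp: Z_def)
      next
        case False
        then show ?thesis using away[of x] xR by (auto simp: Z_def)
      qed
    qed
  qed auto
  then show False using z p(1) RL by (auto simp: Z_def)
qed

section \<open>Construction of jump loops and descent\<close>

lemma graph_path_connected: "path_connected (graph_of f)"
  using path_connected_if_locally_connected[OF closed_graph graph_locally_connected _ connected_graph]
  by (simp add: openin_subtopology_self)

text \<open>
  A path in the graph from a point over the interior to \<open>(p, f p)\<close> must reach the boundary curve, and from there one can
  proceed over the curve itself.
\<close>

lemma region_graph_path_connected:
  assumes loop: "jump_loop g p"
  shows "path_connected ((\<lambda>z. (z, f z)) ` (inside (path_image g) \<union> path_image g))"
proof -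
  define L where "L = path_image g"
  define R where "R = inside L"
  let ?G = "\<lambda>S. (\<lambda>z. (z, f z)) ` S"
  have g: "simple_path g" "pathfinish g = pathstart g" and p: "p \<in> L" and pcL: "path_connected (?G L)"
    using loop unfolding jump_loop_def L_def by auto
  note Jio = Jordan_inside_outside[OF g, folded L_def, folded R_def]
  have openR: "open R" and clR: "closure R = R \<union> L" and RL: "R \<inter> L = {}"
    using Jio inside_no_overlap[of L] closure_Un_frontier[of R] by (auto simp: R_def)
  have reach: "path_component (?G (R \<union> L)) (x, f x) (p, f p)" if x: "x \<in> R \<union> L" for x
  proof -
    have onL: "path_component (?G (R \<union> L)) (w, f w) (p, f p)" if "w \<in> L" for w
    proof -
      have "path_component (?G L) (w, f w) (p, f p)"
        using pcL that p unfolding path_connected_component by blast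
      then show ?thesis by (rule path_component_of_subset[rotated]) blast
    qed
    show ?thesis
    proof (cases "x \<in> L")
      case True then show ?thesis by (rule onL)
    next
      case False
      then have xR: "x \<in> R" using x by blast
      have "(x, f x) \<in> graph_of f" "(p, f p) \<in> graph_of f" by (auto simp: graph_of_def)
      then obtain \<gamma> where \<gamma>: "path \<gamma>" "path_image \<gamma> \<subseteq> graph_of f" "pathstart \<gamma> = (x, f x)" "pathfinish \<gamma> = (p, f p)"
        using graph_path_connected unfolding path_connected_def by metis
      let ?S = "R \<times> (UNIV :: real set)"
      have openS: "open ?S" using openR by (simp add: open_Times)
      have "pathstart \<gamma> \<in> closure ?S" using xR \<gamma>(3) closure_subset[of ?S] by auto
      moreover have "pathfinish \<gamma> \<notin> ?S" using p RL \<gamma>(4) by auto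
      ultimately obtain h where h: "path h" "pathstart h = pathstart \<gamma>" "path_image h \<subseteq> path_image \<gamma>"
          "path_image h - {pathfinish h} \<subseteq> interior ?S" "pathfinish h \<in> frontier ?S"
        using exists_path_subpath_to_frontier[OF \<gamma>(1)] by metis
      obtain w where w: "pathfinish h = (w, f w)"
        using h(3) \<gamma>(2) pathfinish_in_path_image[of h] by (auto simp: graph_of_def)
      have "(w, f w) \<in> closure ?S" "(w, f w) \<notin> ?S"
        using h(5) w openS by (auto simp: frontier_def interior_open)
      then have wL: "w \<in> L" using clR by (auto simp: closure_Times)
      have "path_image h \<subseteq> ?G (R \<union> L)"
      proof
        fix v assume v: "v \<in> path_image h"
        then obtain u where u: "v = (u, f u)" using h(3) \<gamma>(2) by (auto simp: graph_of_def)
        have "u \<in> R \<union> L"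
        proof (cases "v = pathfinish h")
          case True then show ?thesis using u w wL by auto
        next
          case False
          then have "v \<in> ?S" using h(4) v interior_subset by blast
          then show ?thesis using u by auto
        qed
        then show "v \<in> ?G (R \<union> L)" using u by blast
      qed
      then have "path_component (?G (R \<union> L)) (x, f x) (w, f w)"
        unfolding path_component_def using h(1,2) \<gamma>(3) w by auto
      then show ?thesis using onL[OF wL] by (rule path_component_trans)
    qed
  qed
  have "path_connected (?G (R \<union> L))"
    unfolding path_connected_component
  proof clarify
    fix x y assume xy: "x \<in> R \<union> L" "y \<in> R \<union> L"
    show "path_component (?G (R \<union> L)) (x, f x) (y, f y)"
      by (rule path_component_trans[OF reach[OF xy(1)] path_component_sym[OF reach[OF xy(2)]]])
  qed
  then show ?thesis unfolding R_def L_def .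
qed

lemma cont_on_bounded:
  assumes "\<And>x. x \<in> S \<Longrightarrow> f x \<le> M"
  shows "continuous_on S f"
  unfolding continuous_on_iff
proof (intro ballI allI impI)
  fix x e assume "x \<in> S" and e: "(0::real) < e"
  obtain d where d: "d > 0" "\<And>y. dist x y < d \<Longrightarrow> M < f y \<or> \<bar>f y - f x\<bar> < e"
    using near[OF e, of x M] by blast
  have "dist (f y) (f x) < e" if "y \<in> S" "dist y x < d" for y
    using d(2)[of y] assms[OF that(1)] that(2) by (auto simp: dist_commute dist_real_def)
  then show "\<exists>d>0. \<forall>y\<in>S. dist y x < d \<longrightarrow> dist (f y) (f x) < e" using d(1) by blast
qed

text \<open>
  Since \<open>f|D\<close> is discontinuous at \<open>q\<close>, points \<open>x\<close> of \<open>D\<close> arbitrarily near \<open>q\<close> have large values. Local path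
  connectedness of \<open>D\<close> joins such an \<open>x\<close> to \<open>q\<close> by a short arc in \<open>D\<close> that avoids the other points of \<open>P\<close>. Short of \<open>q\<close>,
  \<open>f\<close> is continuous on the arc and omits the values between \<open>f q + 1\<close> and \<open>f q + 2\<close>, so it remains
  large.
\<close>

lemma high_arc_exists:
  assumes q: "q \<in> P" and U: "open U" "q \<in> U"
  obtains \<rho> where "arc \<rho>" "pathfinish \<rho> = q" "path_image \<rho> \<subseteq> U"
    "continuous_on (path_image \<rho> - {q}) f" "\<And>y. y \<in> path_image \<rho> - {q} \<Longrightarrow> f q + 2 < f y"
proof -
  have qD: "q \<in> D" and jump: "\<not> continuous (at q within D) f"
    using q by (auto simp: P_eq discont_points_def)
  obtain r2 where r2: "r2 > 0" "\<And>y. dist q y < r2 \<Longrightarrow> f q + 2 < f y \<or> \<bar>f y - f q\<bar> < 1"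
    using near[OF zero_less_one, of q "f q + 2"] by blast
  define O' where "O' = U \<inter> - (P - {q}) \<inter> ball q r2"
  have O': "open O'"
    unfolding O'_def using U(1) finite_P by (intro open_Int open_Compl finite_imp_closed) auto
  have qO': "q \<in> O'" using U(2) r2(1) by (simp add: O'_def)
  have "openin (top_of_set D) (D \<inter> O')" using O' by (simp add: openin_open_Int)
  then obtain V where V: "openin (top_of_set D) V" "connected V" "q \<in> V" "V \<subseteq> D \<inter> O'"
    using D_locally_connected qO' qD unfolding locally_connected by (metis IntI)
  have pcV: "path_connected V"
    using path_connected_if_locally_connected[OF compact_imp_closed[OF compact_D] D_locally_connected V(1,2)] .
  obtain T where T: "open T" "V = D \<inter> T" using V(1) openin_open by metis
  obtain d where d: "d > 0" "ball q d \<subseteq> T" using T V(3) open_contains_ball by blast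
  obtain e where e: "e > 0" "\<And>d. d > 0 \<Longrightarrow> \<exists>x\<in>D. dist q x < d \<and> e \<le> \<bar>f x - f q\<bar>"
    using jump unfolding continuous_within_eps_delta dist_real_def by (metis dist_commute not_le)
  obtain r where r: "r > 0" "\<And>y. dist q y < r \<Longrightarrow> f q + 2 < f y \<or> \<bar>f y - f q\<bar> < e"
    using near[OF e(1), of q "f q + 2"] by blast
  obtain x where x: "x \<in> D" "dist q x < min d r" "e \<le> \<bar>f x - f q\<bar>"
    using e(2)[of "min d r"] d r by auto
  then have fx: "f q + 2 < f x" using r(2)[of x] by auto
  have xV: "x \<in> V" using x d T by auto
  have xq: "x \<noteq> q" using fx by auto
  obtain \<gamma> where \<gamma>: "path \<gamma>" "path_image \<gamma> \<subseteq> V" "pathstart \<gamma> = x" "pathfinish \<gamma> = q"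
    using pcV xV V(3) unfolding path_connected_def by metis
  obtain \<rho> where \<rho>: "arc \<rho>" "path_image \<rho> \<subseteq> path_image \<gamma>" "pathstart \<rho> = x" "pathfinish \<rho> = q"
    using path_contains_arc[OF \<gamma>(1,3,4) xq] by blast
  have im: "path_image \<rho> \<subseteq> D \<inter> O'" using \<rho>(2) \<gamma>(2) V(4) by blast
  define C where "C = path_image \<rho> - {q}"
  have CDP: "C \<subseteq> D - P" using im by (auto simp: C_def O'_def)
  have contC: "continuous_on C f" using continuous_on_subset[OF cont_on_D_minus_P CDP] .
  have inj: "inj_on \<rho> {0..1}" and cont\<rho>: "continuous_on {0..1} \<rho>" and ends: "\<rho> 0 = x" "\<rho> 1 = q"
    using \<rho> by (auto simp: arc_def path_def pathstart_def pathfinish_def)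
  have "C = \<rho> ` {0..<1}"
  proof
    have "{0..1} = insert 1 {0..<1::real}" by auto
    then show "C \<subseteq> \<rho> ` {0..<1}" unfolding C_def path_image_def using ends by auto
    show "\<rho> ` {0..<1} \<subseteq> C"
    proof clarify
      fix u :: real assume u: "u \<in> {0..<1}"
      then have "\<rho> u \<noteq> \<rho> 1" using inj_onD[OF inj, of u 1] by auto
      then show "\<rho> u \<in> C" using u ends unfolding C_def path_image_def by auto
    qed
  qed
  moreover have "connected (\<rho> ` {0..<1})"
    by (intro connected_continuous_image continuous_on_subset[OF cont\<rho>]) auto
  ultimately have "connected (f ` C)" using contC connected_continuous_image by blast
  moreover have xC: "x \<in> C" using xq \<rho>(3) pathstart_in_path_image[of \<rho>] by (auto simp: C_def)
  have gap: "f q + 2 < f y \<or> \<bar>f y - f q\<bar> < 1" if "y \<in> C" for y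
    using that im r2(2)[of y] by (auto simp: C_def O'_def)
  have high: "f q + 2 < f y" if y: "y \<in> C" for y
  proof (rule ccontr)
    assume "\<not> f q + 2 < f y"
    then have "f y < f q + 1" using gap[OF y] by auto
    then have "f q + 3/2 \<in> {f y..f x}" using fx by auto
    moreover have "is_interval (f ` C)" using \<open>connected (f ` C)\<close> is_interval_connected_1 by blast
    ultimately have "f q + 3/2 \<in> f ` C"
      using y xC unfolding is_interval_1 by (meson atLeastAtMost_iff imageI)
    then show False using gap by force
  qed
  show ?thesis
  proof (rule that[OF \<rho>(1,4)])
    show "path_image \<rho> \<subseteq> U" using im by (auto simp: O'_def)
  qed (use contC high in \<open>auto simp: C_def\<close>)
qed

text \<open>
  Let \<open>\<rho>\<close> be an arc into \<open>q\<close> with high values, starting at \<open>x\<close>, and let \<open>\<eta>\<close> be an arc from \<open>q\<close> to \<open>x\<close> that comes from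
  an arc in the graph. The loop follows \<open>\<eta>\<close> up to the last point \<open>z\<close> of \<open>\<rho>\<close> before \<open>q\<close> that lies on \<open>\<eta>\<close>, and then
  \<open>\<rho>\<close> back to \<open>q\<close>. Such a last point exists: \<open>f\<close> is continuous on \<open>\<eta>\<close>, hence close to \<open>f q\<close> on \<open>\<eta>\<close> near
  \<open>q\<close>, and there \<open>\<rho>\<close> carries high values only.
\<close>

lemma jump_loop_exists:
  assumes q: "q \<in> P" and U: "open U" "q \<in> U" "U \<subseteq> W"
    and W: "path_connected ((\<lambda>z. (z, f z)) ` W)"
  obtains g where "jump_loop g q" "path_image g \<subseteq> W"
proof -
  let ?G = "\<lambda>S. (\<lambda>z. (z, f z)) ` S"
  obtain \<rho> where \<rho>: "arc \<rho>" "pathfinish \<rho> = q" "path_image \<rho> \<subseteq> U"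
    "continuous_on (path_image \<rho> - {q}) f" "\<And>y. y \<in> path_image \<rho> - {q} \<Longrightarrow> f q + 2 < f y"
    using high_arc_exists[OF q U(1,2)] by blast
  define x where "x = pathstart \<rho>"
  have inj: "inj_on \<rho> {0..1}" and cont\<rho>: "continuous_on {0..1} \<rho>" and ends: "\<rho> 0 = x" "\<rho> 1 = q"
    using \<rho> by (auto simp: arc_def path_def pathstart_def pathfinish_def x_def)
  have ne_q: "\<rho> u \<noteq> q" "\<rho> u \<in> path_image \<rho>" if "0 \<le> u" "u < 1" for u
    using inj_onD[OF inj, of u 1] that ends by (auto simp: path_image_def)
  have xq: "x \<noteq> q" using ne_q[of 0] ends by auto
  have xW: "x \<in> W" using \<rho>(3) U(3) pathstart_in_path_image[of \<rho>] by (auto simp: x_def)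
  have qW: "q \<in> W" using U by auto
  have "(q, f q) \<in> ?G W" "(x, f x) \<in> ?G W" using qW xW by auto
  then have "path_component (?G W) (q, f q) (x, f x)"
    using W unfolding path_connected_component by blast
  then obtain \<gamma> where \<gamma>: "path \<gamma>" "path_image \<gamma> \<subseteq> ?G W" "pathstart \<gamma> = (q, f q)" "pathfinish \<gamma> = (x, f x)"
    unfolding path_component_def by blast
  obtain \<zeta> where \<zeta>: "arc \<zeta>" "path_image \<zeta> \<subseteq> path_image \<gamma>" "pathstart \<zeta> = (q, f q)" "pathfinish \<zeta> = (x, f x)"
    using path_contains_arc[OF \<gamma>(1,3,4)] xq by blast
  have \<zeta>G: "path_image \<zeta> \<subseteq> ?G W" using \<zeta>(2) \<gamma>(2) by blast
  define \<eta> where "\<eta> = fst \<circ> \<zeta>"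
  have arc\<eta>: "arc \<eta>"
    unfolding arc_def
  proof
    show "path \<eta>" unfolding \<eta>_def using \<zeta>(1) by (auto simp: arc_def intro!: path_continuous_image continuous_intros)
    have "inj_on fst (path_image \<zeta>)" by (rule inj_on_subset[OF _ \<zeta>G]) (auto simp: inj_on_def)
    then show "inj_on \<eta> {0..1}"
      unfolding \<eta>_def using \<zeta>(1) by (auto simp: arc_def path_image_def intro: comp_inj_on)
  qed
  define H where "H = path_image \<eta>"
  have HW: "H \<subseteq> W" using \<zeta>G by (auto simp: H_def \<eta>_def path_image_compose)
  have ends\<eta>: "\<eta> 0 = q" "\<eta> 1 = x" using \<zeta>(3,4) by (auto simp: \<eta>_def pathstart_def pathfinish_def)
  have compH: "compact H" unfolding H_def using arc\<eta> by (simp add: compact_arc_image)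
  have "bounded (snd ` path_image \<zeta>)"
    using \<zeta>(1) by (intro compact_imp_bounded compact_continuous_image) (auto simp: compact_arc_image intro: continuous_intros)
  then obtain M where M: "\<And>w. w \<in> path_image \<zeta> \<Longrightarrow> snd w \<le> M"
    unfolding bounded_real by (metis abs_le_D1 imageI)
  have fH: "f y \<le> M" if "y \<in> H" for y
  proof -
    have "y \<in> fst ` path_image \<zeta>" using that by (simp add: H_def \<eta>_def path_image_compose)
    then obtain w where "w \<in> path_image \<zeta>" "y = fst w" by blast
    then show ?thesis using M[of w] \<zeta>G by auto
  qed
  have contH: "continuous_on H f" using cont_on_bounded[OF fH] .
  have qH: "q \<in> H" and xH: "x \<in> H" using ends\<eta> by (auto simp: H_def path_image_def)
  define T where "T = {0..1} \<inter> \<rho> -` H"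
  have closedT: "closed T"
    unfolding T_def using cont\<rho> compH by (intro continuous_closed_preimage) (auto simp: compact_imp_closed)
  \<comment> \<open>Near its end \<open>q\<close> the arc \<open>\<rho>\<close> does not meet \<open>H\<close>.\<close>
  obtain u0 where u0: "u0 < 1" "\<And>u. u0 < u \<Longrightarrow> u < 1 \<Longrightarrow> u \<notin> T"
  proof -
    obtain d where d: "d > 0" "\<And>y. y \<in> H \<Longrightarrow> dist y q < d \<Longrightarrow> dist (f y) (f q) < 1"
      using contH qH unfolding continuous_on_iff by (metis zero_less_one)
    obtain e where e: "e > 0" "\<And>u. u \<in> {0..1} \<Longrightarrow> dist u 1 < e \<Longrightarrow> dist (\<rho> u) q < d"
      using cont\<rho> d(1) ends unfolding continuous_on_iff by (metis atLeastAtMost_iff order_refl zero_le_one)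
    have "u \<notin> T" if u: "1 - min e 1 < u" "u < 1" for u
    proof
      assume "u \<in> T"
      then have u': "u \<in> {0..1}" "\<rho> u \<in> H" by (auto simp: T_def)
      then have "dist (f (\<rho> u)) (f q) < 1" using d(2) e(2)[of u] u by (auto simp: dist_real_def)
      moreover have "f q + 2 < f (\<rho> u)" using \<rho>(5)[of "\<rho> u"] ne_q[of u] u' u by auto
      ultimately show False by (auto simp: dist_real_def)
    qed
    then show ?thesis using that[of "1 - min e 1"] e(1) by auto
  qed
  have T0: "T \<inter> {..u0} \<noteq> {}" using xH ends u0(2)[of 0] by (force simp: T_def not_less)
  moreover have "compact (T \<inter> {..u0})"
    unfolding compact_eq_bounded_closed
  proof
    show "bounded (T \<inter> {..u0})" by (rule bounded_subset[of "{0..1}"]) (auto simp: T_def)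
    show "closed (T \<inter> {..u0})" using closedT by (intro closed_Int) auto
  qed
  ultimately obtain u where u: "u \<in> T" "u \<le> u0" "\<And>v. v \<in> T \<Longrightarrow> v \<le> u0 \<Longrightarrow> v \<le> u"
    using compact_attains_sup[of "T \<inter> {..u0}"] by auto
  have u01: "0 \<le> u" "u < 1" using u(1,2) u0(1) by (auto simp: T_def)
  define z where "z = \<rho> u"
  have zH: "z \<in> H" using u(1) by (auto simp: T_def z_def)
  have zq: "z \<noteq> q" using ne_q[OF u01] by (simp add: z_def)
  obtain v where v: "v \<in> {0..1}" "\<eta> v = z" using zH unfolding H_def path_image_def by blast
  have v0: "v \<noteq> 0" using v(2) zq ends\<eta> by auto
  define g1 where "g1 = subpath 0 v \<eta>"
  define g2 where "g2 = subpath u 1 \<rho>"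
  have arc1: "arc g1" unfolding g1_def using arc\<eta> v v0 by (intro arc_subpath_arc) auto
  have arc2: "arc g2" unfolding g2_def using \<rho>(1) u01 by (intro arc_subpath_arc) auto
  have e1: "pathstart g1 = q" "pathfinish g1 = z" using ends\<eta> v by (auto simp: g1_def)
  have e2: "pathstart g2 = z" "pathfinish g2 = q" using ends by (auto simp: g2_def z_def)
  have im1: "path_image g1 \<subseteq> H" unfolding g1_def H_def using v by (intro path_image_subpath_subset) auto
  have im2: "path_image g2 = \<rho> ` {u..1}" using u01 by (simp add: g2_def path_image_subpath)
  have im2': "path_image g2 \<subseteq> path_image \<rho>" unfolding im2 using u01 by (auto simp: path_image_def)
  have meet: "path_image g1 \<inter> path_image g2 \<subseteq> {q, z}"
  proof
    fix y assume y: "y \<in> path_image g1 \<inter> path_image g2"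
    then obtain w where w: "u \<le> w" "w \<le> 1" "y = \<rho> w" unfolding im2 by auto
    show "y \<in> {q, z}"
    proof (cases "w = 1")
      case True then show ?thesis using w ends by simp
    next
      case False
      have "w \<in> T" using y w u01 im1 by (auto simp: T_def)
      then have "w \<le> u" using u(3) u0(2)[of w] w(2) False by force
      then show ?thesis using w by (simp add: z_def)
    qed
  qed
  define g where "g = g1 +++ g2"
  have simple: "simple_path g"
    unfolding g_def using meet e1 e2 by (intro simple_path_join_loop arc1 arc2) auto
  have L: "path_image g = path_image g1 \<union> path_image g2"
    unfolding g_def using e1 e2 by (simp add: path_image_join)
  have cont1: "continuous_on (path_image g1) f" using contH im1 continuous_on_subset by blast
  have cont2: "continuous_on (path_image g2 - {q}) f"
    using \<rho>(4) im2' by (meson Diff_mono continuous_on_subset subset_refl)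
  have cl1: "closed (path_image g1)" "closed (path_image g2)"
    using arc1 arc2 by (auto simp: closed_arc_image)
  have "continuous_on ((path_image g1 - {q}) \<union> (path_image g2 - {q})) f"
  proof (rule continuous_on_Un_local)
    let ?S = "path_image g1 - {q} \<union> (path_image g2 - {q})"
    have "path_image g1 - {q} = ?S \<inter> path_image g1" "path_image g2 - {q} = ?S \<inter> path_image g2" by auto
    then show "closedin (top_of_set ?S) (path_image g1 - {q})" "closedin (top_of_set ?S) (path_image g2 - {q})"
      using cl1 closedin_closed_Int by metis+
  qed (use cont1 cont2 continuous_on_subset in blast)+
  then have contL: "continuous_on (path_image g - {q}) f" by (simp add: L Un_Diff)
  have half: "path_image g2 - {q} = \<rho> ` {u..<1}"
  proof
    have "{u..1} = insert 1 {u..<1}" using u01 by auto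
    then show "path_image g2 - {q} \<subseteq> \<rho> ` {u..<1}" unfolding im2 using ends by auto
    show "\<rho> ` {u..<1} \<subseteq> path_image g2 - {q}"
    proof clarify
      fix w assume "w \<in> {u..<1}"
      then show "\<rho> w \<in> path_image g2 - {q}" unfolding im2 using ne_q(1)[of w] u01 by auto
    qed
  qed
  have pc1: "path_connected (?G (path_image g1))"
    using arc1 by (intro path_connected_continuous_image continuous_intros cont1) (simp add: path_connected_path_image arc_imp_path)
  have "path_connected (\<rho> ` {u..<1})"
    by (intro path_connected_continuous_image continuous_on_subset[OF cont\<rho>] convex_imp_path_connected) (use u01 in auto)
  then have pc2: "path_connected (?G (path_image g2 - {q}))"
    unfolding half[symmetric] by (intro path_connected_continuous_image continuous_intros cont2)
  have "z \<in> path_image g1" "z \<in> path_image g2 - {q}"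
    using e1 e2 zq pathfinish_in_path_image[of g1] pathstart_in_path_image[of g2] by auto
  then have "?G (path_image g1) \<inter> ?G (path_image g2 - {q}) \<noteq> {}" by blast
  then have "path_connected (?G (path_image g1) \<union> ?G (path_image g2 - {q}))"
    by (rule path_connected_Un[OF pc1 pc2])
  moreover have q1: "q \<in> path_image g1" using e1 pathstart_in_path_image[of g1] by auto
  then have "?G (path_image g) = ?G (path_image g1) \<union> ?G (path_image g2 - {q})"
    unfolding L by blast
  ultimately have pcG: "path_connected (?G (path_image g))" by simp
  have jump: "\<not> continuous (at q within path_image g) f"
  proof
    assume "continuous (at q within path_image g) f"
    then obtain d where d: "d > 0" "\<And>y. y \<in> path_image g \<Longrightarrow> dist y q < d \<Longrightarrow> dist (f y) (f q) < 1"
      unfolding continuous_within_eps_delta by (metis zero_less_one)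
    obtain e where e: "e > 0" "\<And>u. u \<in> {0..1} \<Longrightarrow> dist u 1 < e \<Longrightarrow> dist (\<rho> u) q < d"
      using cont\<rho> d(1) ends unfolding continuous_on_iff by (metis atLeastAtMost_iff order_refl zero_le_one)
    define w where "w = max u (1 - e / 2)"
    have w: "u \<le> w" "w < 1" "dist w 1 < e" using u01 e(1) by (auto simp: w_def dist_real_def)
    then have "\<rho> w \<in> path_image g2 - {q}" "dist (\<rho> w) q < d" using half e(2)[of w] u01 by auto
    then show False using d(2)[of "\<rho> w"] \<rho>(5)[of "\<rho> w"] im2' L by (auto simp: dist_real_def)
  qed
  have "path_image g \<subseteq> W" using L im1 HW im2' \<rho>(3) U(3) by blast
  moreover have "jump_loop g q"
    unfolding jump_loop_def using simple contL pcG jump q q1 L e1 e2 by (auto simp: g_def)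
  ultimately show ?thesis using that by blast
qed

text \<open>
  By descent on the number of enclosed points of \<open>P\<close>: an enclosed \<open>q \<in> P\<close> carries a jump loop within the
  closed region, whose inside is smaller and omits \<open>q\<close>.
\<close>

lemma no_jump_loop: "\<not> jump_loop g p"
proof (induction "card (inside (path_image g) \<inter> P)" arbitrary: g p rule: less_induct)
  case less
  show ?case
  proof
    assume loop: "jump_loop g p"
    then have g: "simple_path g" "pathfinish g = pathstart g" by (auto simp: jump_loop_def)
    obtain q where q: "q \<in> P" "q \<in> inside (path_image g)" using jump_loop_encloses_P[OF loop] by blast
    obtain h where h: "jump_loop h q" "path_image h \<subseteq> inside (path_image g) \<union> path_image g"
      using jump_loop_exists[OF q(1) _ q(2) _ region_graph_path_connected[OF loop]] Jordan_inside_outside[OF g]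
      by blast
    then have h': "simple_path h" "pathfinish h = pathstart h" "q \<in> path_image h" by (auto simp: jump_loop_def)
    have "inside (path_image h) \<subseteq> inside (path_image g)" using inside_Jordan_mono[OF g h'(1,2) h(2)] .
    moreover have "q \<notin> inside (path_image h)" using h'(3) inside_no_overlap[of "path_image h"] by blast
    ultimately have "inside (path_image h) \<inter> P \<subset> inside (path_image g) \<inter> P" using q by blast
    then have "card (inside (path_image h) \<inter> P) < card (inside (path_image g) \<inter> P)"
      using finite_P by (intro psubset_card_mono) auto
    then show False using less h(1) by blast
  qed
qed

theorem P_empty: "P = {}"
proof (rule ccontr)
  assume "P \<noteq> {}"
  then obtain q where "q \<in> P" by blast
  moreover have "graph_of f = (\<lambda>z. (z, f z)) ` UNIV" by (auto simp: graph_of_def)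
  ultimately obtain g where "jump_loop g q"
    using jump_loop_exists[of q UNIV UNIV] graph_path_connected by auto
  then show False using no_jump_loop by blast
qed

end

section \<open>Transfer to the real plane\<close>

lemma continuous_within_homeomorphic_image:
  fixes \<phi> :: "'a::t2_space \<Rightarrow> 'b::t2_space" and \<psi> :: "'b \<Rightarrow> 'a"
  assumes cont: "continuous_on UNIV \<phi>" "continuous_on UNIV \<psi>"
    and inv: "\<And>z. \<psi> (\<phi> z) = z" "\<And>x. \<phi> (\<psi> x) = x"
  shows "continuous (at (\<psi> x) within \<psi> ` S) (f \<circ> \<phi>) \<longleftrightarrow> continuous (at x within S) f"
proof
  assume *: "continuous (at (\<psi> x) within \<psi> ` S) (f \<circ> \<phi>)"
  have "continuous (at x within S) \<psi>"
    using cont(2) by (meson UNIV_I continuous_on_eq_continuous_within continuous_within_subset subset_UNIV)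
  then have "continuous (at x within S) ((f \<circ> \<phi>) \<circ> \<psi>)"
    using * by (rule continuous_within_compose)
  moreover have "(f \<circ> \<phi>) \<circ> \<psi> = f" using inv(2) by (simp add: fun_eq_iff)
  ultimately show "continuous (at x within S) f" by simp
next
  assume *: "continuous (at x within S) f"
  have "continuous (at (\<psi> x) within \<psi> ` S) \<phi>"
    using cont(1) by (meson UNIV_I continuous_on_eq_continuous_within continuous_within_subset subset_UNIV)
  moreover have "\<phi> ` \<psi> ` S = S" using inv(2) by (simp add: image_comp o_def)
  ultimately show "continuous (at (\<psi> x) within \<psi> ` S) (f \<circ> \<phi>)"
    using * inv(2) by (intro continuous_within_compose) simp_all
qed

lemma discont_points_homeomorphic_image:
  fixes \<phi> :: "'a::t2_space \<Rightarrow> 'b::t2_space" and \<psi> :: "'b \<Rightarrow> 'a"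
  assumes "continuous_on UNIV \<phi>" "continuous_on UNIV \<psi>"
    and "\<And>z. \<psi> (\<phi> z) = z" "\<And>x. \<phi> (\<psi> x) = x"
  shows "discont_points (\<psi> ` S) (f \<circ> \<phi>) = \<psi> ` discont_points S f"
  using continuous_within_homeomorphic_image[OF assms] by (auto simp: discont_points_def)

theorem lemma35:
  fixes f :: "real ^ 2 \<Rightarrow> real"
    and D :: "(real ^ 2) set"
  defines "D \<equiv> discont_points UNIV f"
  assumes nonneg: "\<And>x. f x \<in> {0..}"
    and graph_closed: "closedin (top_of_set (UNIV \<times> {0..})) (graph_of f)"
    and graph_connected: "connected (graph_of f)"
    and graph_locally_connected: "locally connected (graph_of f)"
    and D_nonempty: "D \<noteq> {}"
    and D_continuum: "continuum D"
    and D_locally_connected: "locally connected D"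
    and D_not_separated: "not_separated_by_any_point D"
    and restriction_discontinuous: "\<not> continuous_on D f"
  shows "infinite (discont_points D f)"
proof
  assume fin: "finite (discont_points D f)"
  define \<phi> :: "complex \<Rightarrow> real ^ 2" where "\<phi> z = vector [Re z, Im z]" for z
  define \<psi> :: "real ^ 2 \<Rightarrow> complex" where "\<psi> v = Complex (v $ 1) (v $ 2)" for v
  have inv: "\<And>z. \<psi> (\<phi> z) = z" "\<And>x. \<phi> (\<psi> x) = x"
    by (auto simp: \<phi>_def \<psi>_def vec_eq_iff forall_2)
  have \<phi>: "continuous_on A \<phi>" for A
  proof -
    have "continuous_on A (\<lambda>z. if i = 1 then Re z else Im z)" for i :: 2
      by (cases "i = 1") (auto intro!: continuous_intros)
    then have "continuous_on A (\<lambda>z. \<chi> i::2. if i = 1 then Re z else Im z)"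
      by (rule continuous_on_vec_lambda)
    moreover have "\<phi> = (\<lambda>z. \<chi> i::2. if i = 1 then Re z else Im z)"
      by (auto simp: \<phi>_def fun_eq_iff vec_eq_iff forall_2)
    ultimately show ?thesis by simp
  qed
  have \<psi>: "continuous_on A \<psi>" for A
    unfolding \<psi>_def Complex_eq by (intro continuous_intros)
  have discont: "discont_points (\<psi> ` S) (f \<circ> \<phi>) = \<psi> ` discont_points S f" for S
    by (rule discont_points_homeomorphic_image) (fact \<phi> \<psi> inv)+
  have in_graph: "(a, b) \<in> graph_of h \<longleftrightarrow> b = h a" for a b and h :: "'x \<Rightarrow> 'y"
    by (simp add: graph_of_def)
  have graph_eq: "graph_of (f \<circ> \<phi>) = map_prod \<phi> id -` graph_of f"
    by (auto simp: in_graph)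
  have graph_image: "graph_of (f \<circ> \<phi>) = map_prod \<psi> id ` graph_of f"
  proof (intro set_eqI iffI)
    fix w assume "w \<in> graph_of (f \<circ> \<phi>)"
    then have "map_prod \<phi> id w \<in> graph_of f" "w = map_prod \<psi> id (map_prod \<phi> id w)"
      by (auto simp: graph_eq inv map_prod_def split: prod.splits)
    then show "w \<in> map_prod \<psi> id ` graph_of f" by blast
  next
    fix w assume "w \<in> map_prod \<psi> id ` graph_of f"
    then show "w \<in> graph_of (f \<circ> \<phi>)" by (auto simp: graph_eq inv)
  qed
  have cont_pair: "continuous_on A (map_prod \<psi> id)" "continuous_on B (map_prod \<phi> id)"
    for A :: "((real ^ 2) \<times> real) set" and B :: "(complex \<times> real) set"
    unfolding map_prod_def case_prod_unfold id_def
    by (intro continuous_intros continuous_on_compose2[OF \<psi>] continuous_on_compose2[OF \<phi>]; auto)+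
  have homeo: "graph_of f homeomorphic graph_of (f \<circ> \<phi>)"
  proof (rule homeomorphicI)
    show "map_prod \<psi> id ` graph_of f = graph_of (f \<circ> \<phi>)" by (rule graph_image[symmetric])
    show "map_prod \<phi> id ` graph_of (f \<circ> \<phi>) = graph_of f"
      unfolding graph_image image_image by (simp add: map_prod_def case_prod_unfold inv)
  qed (auto simp: inv intro: cont_pair)
  have homeoD: "D homeomorphic \<psi> ` D"
    by (rule homeomorphicI[of \<psi> D _ \<phi>]) (auto simp: inv image_image intro: \<phi> \<psi>)
  interpret closed_graph_plane "f \<circ> \<phi>" "\<psi> ` D" "\<psi> ` discont_points D f"
  proof
    show "0 \<le> (f \<circ> \<phi>) z" for z using nonneg by simp
    have "closed (graph_of f)"
      using closedin_closed_trans[OF graph_closed] by (simp add: closed_Times)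
    then show "closed (graph_of (f \<circ> \<phi>))"
      unfolding graph_eq using cont_pair(2) by (intro closed_vimage) auto
    show "connected (graph_of (f \<circ> \<phi>))"
      unfolding graph_image by (intro connected_continuous_image cont_pair graph_connected)
    show "locally connected (graph_of (f \<circ> \<phi>))"
      using graph_locally_connected homeomorphic_locally[OF homeo, of connected connected] homeomorphic_connectedness by blast
    show "\<psi> ` D = discont_points UNIV (f \<circ> \<phi>)"
      using discont[of UNIV] surj_def inv(1) unfolding D_def by (metis surjI)
    show "\<psi> ` discont_points D f = discont_points (\<psi> ` D) (f \<circ> \<phi>)" using discont by simp
    show "compact (\<psi> ` D)" "connected (\<psi> ` D)"
      using D_continuum \<psi> unfolding continuum_def by (auto intro: compact_continuous_image connected_continuous_image)
    show "locally connected (\<psi> ` D)" using D_locally_connected homeomorphic_locally[OF homeoD, of connected connected] homeomorphic_connectedness by blast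
    show "connected (\<psi> ` D - {p})" if p: "p \<in> \<psi> ` D" for p
    proof -
      have "\<psi> ` D - {p} = \<psi> ` (D - {\<phi> p})" using inv by force
      moreover have "connected (D - {\<phi> p})"
        using D_not_separated p inv unfolding not_separated_by_any_point_def by auto
      ultimately show ?thesis using \<psi> connected_continuous_image by metis
    qed
    show "finite (\<psi> ` discont_points D f)" using fin by simp
  qed
  have "discont_points D f = {}" using P_empty by simp
  then have "continuous_on D f"
    unfolding continuous_on_eq_continuous_within discont_points_def by blast
  then show False using restriction_discontinuous by contradiction
qed

end
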